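(* There are only finitely many pairs $(a,b)\in\mathbf{C}^2$ with $4a^3+27b^2\neq 0$ such that the three points $$(1,\sqrt{1+a+b}),\quad (2,\sqrt{8+2a+b}),\quad\text{and}\quad (3,\sqrt{27+3a+b})$$ are all torsion points on the elliptic curve given in Weierstrass form by $y^2=x^3+ax+b$.
   Context: The group law on $y^2=x^3+ax+b$ is the usual one, with the point at infinity as neutral element. The choice of the square roots is irrelevant, since $(x,-y)=-(x,y)$ in the group law. *)

theory Defs
  imports Complex_Main "HOL-Algebra.Group"
begin

datatype 'a ec_point = Infinity | Affine 'a 'a

fun on_curve :: "'a::field \<Rightarrow> 'a \<Rightarrow> 'a ec_point \<Rightarrow> bool" where
  "on_curve a b Infinity \<longleftrightarrow> True"
| "on_curve a b (Affine x y) \<longleftrightarrow> y ^ 2 = x ^ 3 + a * x + b"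

fun ec_neg :: "'a::field ec_point \<Rightarrow> 'a ec_point" where
  "ec_neg Infinity = Infinity"
| "ec_neg (Affine x y) = Affine x (- y)"

text \<open>
  Chord-tangent addition: \<open>l\<close> is the slope of the line through the two points, or of the
  tangent if they coincide. For two points on the curve, \<open>x1 = x2\<close> forces
  \<open>y1 = y2\<close> or \<open>y1 = - y2\<close>, so the tangent case is a genuine doubling with \<open>y1 \<noteq> 0\<close>.
  The coefficient \<open>b\<close> does not enter the formulas.
\<close>
fun ec_add :: "'a::field \<Rightarrow> 'a ec_point \<Rightarrow> 'a ec_point \<Rightarrow> 'a ec_point" where
  "ec_add a Infinity Q = Q"
| "ec_add a (Affine x1 y1) Infinity = Affine x1 y1"
| "ec_add a (Affine x1 y1) (Affine x2 y2) =
     (if x1 = x2 \<and> y1 = - y2 then Infinity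
      else let l = (if x1 = x2 then (3 * x1 ^ 2 + a) / (2 * y1) else (y2 - y1) / (x2 - x1));
               x3 = l ^ 2 - x1 - x2
           in Affine x3 (l * (x1 - x3) - y1))"

definition ec_group :: "'a::field \<Rightarrow> 'a \<Rightarrow> 'a ec_point monoid" where
  "ec_group a b = \<lparr>carrier = {P. on_curve a b P}, mult = ec_add a, one = Infinity\<rparr>"

definition ec_torsion :: "'a::field \<Rightarrow> 'a \<Rightarrow> 'a ec_point \<Rightarrow> bool" where
  "ec_torsion a b P \<longleftrightarrow>
     P \<in> carrier (ec_group a b) \<and>
     (\<exists>n::nat. n > 0 \<and> P [^]\<^bsub>ec_group a b\<^esub> n = \<one>\<^bsub>ec_group a b\<^esub>)"

lemma on_curve_neg: "on_curve a b (ec_neg P) \<longleftrightarrow> on_curve a b P"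
  by (cases P) auto

lemma ec_neg_neg: "ec_neg (ec_neg P) = P"
  by (cases P) auto

lemma ec_add_neg: "ec_add a P (ec_neg P) = Infinity"
  by (cases P) auto

lemma on_curve_add:
  fixes a b :: "'a::field_char_0"
  assumes "on_curve a b P" "on_curve a b Q"
  shows "on_curve a b (ec_add a P Q)"
proof (cases P)
  case Infinity
  then show ?thesis using assms by simp
next
  case P: (Affine x1 y1)
  show ?thesis
  proof (cases Q)
    case Infinity
    then show ?thesis using assms P by simp
  next
    case Q: (Affine x2 y2)
    have e1: "y1 ^ 2 = x1 ^ 3 + a * x1 + b" and e2: "y2 ^ 2 = x2 ^ 3 + a * x2 + b"
      using assms P Q by auto
    show ?thesis
    proof (cases "x1 = x2 \<and> y1 = - y2")
      case True
      then show ?thesis using P Q by simp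
    next
      case False
      define l where
        "l = (if x1 = x2 then (3 * x1 ^ 2 + a) / (2 * y1) else (y2 - y1) / (x2 - x1))"
      have add: "ec_add a P Q =
          Affine (l ^ 2 - x1 - x2) (l * (x1 - (l ^ 2 - x1 - x2)) - y1)"
        using False P Q unfolding l_def by (auto simp: Let_def)
      show ?thesis
      proof (cases "x1 = x2")
        case True
        have "(y1 - y2) * (y1 + y2) = 0"
          using e1 e2 True by (simp add: algebra_simps power2_eq_square)
        then have "y1 = y2" using False True by (auto simp: eq_neg_iff_add_eq_0)
        then have "y1 \<noteq> 0" using False True by auto
        then have l: "2 * y1 * l = 3 * x1 ^ 2 + a" using True by (simp add: l_def)
        have "(l * (x1 - (l ^ 2 - x1 - x1)) - y1) ^ 2
            = (l ^ 2 - x1 - x1) ^ 3 + a * (l ^ 2 - x1 - x1) + b"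
          using l e1 by algebra
        then show ?thesis using add True by simp
      next
        case False
        then have ne: "x2 - x1 \<noteq> 0" by simp
        have l: "(x2 - x1) * l = y2 - y1" using False by (simp add: l_def)
        have "(x2 - x1) * ((l * (x1 - (l ^ 2 - x1 - x2)) - y1) ^ 2)
            = (x2 - x1) * ((l ^ 2 - x1 - x2) ^ 3 + a * (l ^ 2 - x1 - x2) + b)"
          using l e1 e2 by algebra
        then show ?thesis using add ne by simp
      qed
    qed
  qed
qed

lemma ec_neg_add: "ec_neg (ec_add a P Q) = ec_add a (ec_neg P) (ec_neg Q)"
proof (cases P; cases Q)
  fix x1 y1 x2 y2 assume PQ: "P = Affine x1 y1" "Q = Affine x2 y2"
  have d: "(- y2 - - y1) / (x2 - x1) = - ((y2 - y1) / (x2 - x1))"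
    by (metis minus_diff_minus minus_divide_left)
  have t: "(3 * x1 ^ 2 + a) / (2 * (- y1)) = - ((3 * x1 ^ 2 + a) / (2 * y1))"
    by simp
  have s: "- y1 = - (- y2) \<longleftrightarrow> y1 = - y2" by (metis minus_minus)
  show ?thesis
    unfolding PQ ec_neg.simps ec_add.simps d t s Let_def
    by (auto simp: algebra_simps)
qed auto

lemma ec_torsion_neg_iff: "ec_torsion a b (ec_neg P) \<longleftrightarrow> ec_torsion a b P"
proof -
  have pow: "ec_neg P [^]\<^bsub>ec_group a b\<^esub> n = ec_neg (P [^]\<^bsub>ec_group a b\<^esub> n)" for n :: nat
    by (induction n) (simp_all add: nat_pow_def ec_group_def ec_neg_add)
  have "ec_neg R = Infinity \<longleftrightarrow> R = Infinity" for R :: "'a ec_point"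
    by (cases R) auto
  then show ?thesis
    unfolding ec_torsion_def pow by (simp add: ec_group_def on_curve_neg)
qed

end

theory Submission
  imports Defs "HOL-Computational_Algebra.Fundamental_Theorem_Algebra"
begin

text \<open>
  Reduction at the prime 2 alone confines the parameters to four explicit pairs.

  The multiples of a torsion point have finitely many \<open>x\<close>-coordinates, so a torsion abscissa lies
  in a finite set \<open>S\<close> that is closed under \<open>x(P) \<mapsto> x(2P)\<close> as long as \<open>2P\<close> is affine
  (\<open>torsion_imp_finite_doubling_closed\<close>). This is the only place where the group law is used.
  Its associativity comes from a uniform description of chords and tangents and a closed formula for
  the slope of the line through \<open>A + B\<close> and \<open>C\<close> (\<open>ec_add_third\<close>).

  Now choose a valuation ring of the complex numbers in which 2 is not invertible; it exists by
  Chevalley's extension theorem (\<open>valuation_ring_extension\<close>). Scale the curve so that the largest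
  difference of two roots of the cubic is a unit. Three facts constrain \<open>S\<close>. Its elements are
  integral, as duplication divides large abscissas by 4 and so drives them to infinity
  (\<open>integral\<close>). Because \<open>x(2P)\<close> is integral in spite of its denominator \<open>4\<close>, any \<open>u\<close> in \<open>S\<close> that is
  not a root makes \<open>u\<^sup>2 + a\<close> divisible by 2 (\<open>square_plus_a\<close>), so all such \<open>u\<close> have the same
  reduction. Finally, if the three roots have distinct reductions, duplication brings points that are
  close still closer together, so that the elements of a finite set keep a minimum distance
  (\<open>separation\<close>).

  The abscissas 1, 2, 3 do not fit these constraints: 1 and 3 are 2-adically close, 1 and 2 are not.
  Suppose at most one of them is a root. If the roots have distinct reductions, then 2 can be as close
  to 1 or 3 as required only if the scaling makes all distances small, and then 1 and 3 are too close
  (\<open>not_three_multiples\<close>). If two roots have the same reduction, then 1, 2, 3 have the same nonzero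
  reduction after scaling, except for the one that is the third root; hence that root is 2. The curve
  is then \<open>Y\<^sup>2 = X (X\<^sup>2 + 6 X + c)\<close> with \<open>X = x - 2\<close>, and doubling the points over \<open>X = 1\<close> and
  \<open>X = - 1\<close> leaves only \<open>c = 1\<close> (\<open>three_multiples\<close>). Together with the three curves for which two of
  1, 2, 3 are roots this makes four pairs (\<open>torsion_parameters\<close>).
\<close>

section \<open>The group law\<close>

text \<open>
  The first equation says that \<open>l\<close> is the slope of the chord, the second that it is the slope
  computed after multiplying through by \<open>y1 + y2\<close>. On the curve each of them yields \<open>l\<close> wherever
  it does not degenerate: the first for \<open>x1 \<noteq> x2\<close>, the second for \<open>y1 \<noteq> - y2\<close>, where it covers the
  tangent. Demanding both makes chords and tangents one case, so the identities below need no
  distinction between addition and doubling.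
\<close>
definition chord_slope :: "'a::field \<Rightarrow> 'a \<Rightarrow> 'a \<Rightarrow> 'a \<Rightarrow> 'a \<Rightarrow> 'a \<Rightarrow> bool" where
  "chord_slope a x1 y1 x2 y2 l \<longleftrightarrow>
     l * (x2 - x1) = y2 - y1 \<and> l * (y1 + y2) = x1 ^ 2 + x1 * x2 + x2 ^ 2 + a"

lemma same_x_cases:
  fixes a b :: "'a::field_char_0"
  assumes "on_curve a b (Affine x y1)" "on_curve a b (Affine x y2)"
  shows "y2 = y1 \<or> y2 = - y1"
  using assms power2_eq_iff[of y2 y1] by auto

lemma chord_slope_exists:
  fixes a b :: "'a::field_char_0"
  assumes "on_curve a b (Affine x1 y1)" "on_curve a b (Affine x2 y2)" "\<not> (x1 = x2 \<and> y1 = - y2)"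
  shows "\<exists>l. chord_slope a x1 y1 x2 y2 l"
proof (cases "x1 = x2")
  case True
  then have "y2 = y1" "y1 \<noteq> 0" using assms same_x_cases[of a b x1 y1 y2] by auto
  then have "chord_slope a x1 y1 x2 y2 ((3 * x1 ^ 2 + a) / (2 * y1))"
    using True by (simp add: chord_slope_def power2_eq_square)
  then show ?thesis by blast
next
  case False
  define l where "l = (y2 - y1) / (x2 - x1)"
  have l: "l * (x2 - x1) = y2 - y1" using False by (simp add: l_def)
  have "(x2 - x1) * (l * (y1 + y2)) = (x2 - x1) * (x1 ^ 2 + x1 * x2 + x2 ^ 2 + a)"
    using l assms(1,2) unfolding on_curve.simps by algebra
  then have "l * (y1 + y2) = x1 ^ 2 + x1 * x2 + x2 ^ 2 + a"
    using False by simp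
  with l show ?thesis by (auto simp: chord_slope_def)
qed

lemma ec_add_chord:
  fixes a b :: "'a::field_char_0"
  assumes "on_curve a b (Affine x1 y1)" "on_curve a b (Affine x2 y2)" "\<not> (x1 = x2 \<and> y1 = - y2)"
    and l: "chord_slope a x1 y1 x2 y2 l"
  shows "ec_add a (Affine x1 y1) (Affine x2 y2) =
           Affine (l ^ 2 - x1 - x2) (l * (x1 - (l ^ 2 - x1 - x2)) - y1)"
proof -
  have "l = (if x1 = x2 then (3 * x1 ^ 2 + a) / (2 * y1) else (y2 - y1) / (x2 - x1))"
  proof (cases "x1 = x2")
    case True
    then have "y2 = y1" "y1 \<noteq> 0" using assms same_x_cases[of a b x1 y1 y2] by auto
    then show ?thesis using l True
      by (simp add: chord_slope_def field_simps power2_eq_square)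
  next
    case False
    then show ?thesis using l by (simp add: chord_slope_def field_simps)
  qed
  then show ?thesis using assms(3) by (simp add: Let_def del: on_curve.simps)
qed

lemma ec_add_commute:
  fixes a b :: "'a::field_char_0"
  assumes P: "on_curve a b P" and Q: "on_curve a b Q"
  shows "ec_add a P Q = ec_add a Q P"
proof (cases "P = Infinity \<or> Q = Infinity \<or> Q = ec_neg P")
  case True
  then show ?thesis
    using ec_add_neg[of a P] ec_add_neg[of a "ec_neg P"] by (cases P; cases Q) (auto simp: ec_neg_neg)
next
  case False
  then obtain x1 y1 x2 y2 where PQ: "P = Affine x1 y1" "Q = Affine x2 y2"
    by (cases P; cases Q) auto
  have ne: "\<not> (x1 = x2 \<and> y1 = - y2)" "\<not> (x2 = x1 \<and> y2 = - y1)" using False PQ by auto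
  obtain l where l: "chord_slope a x1 y1 x2 y2 l"
    using chord_slope_exists ne(1) P Q PQ by blast
  then have l': "chord_slope a x2 y2 x1 y1 l"
    unfolding chord_slope_def by algebra
  have "l * (x1 - (l ^ 2 - x1 - x2)) - y1 = l * (x2 - (l ^ 2 - x2 - x1)) - y2"
    using l unfolding chord_slope_def by algebra
  then show ?thesis
    using ec_add_chord[OF P[unfolded PQ] Q[unfolded PQ] ne(1) l]
      ec_add_chord[OF Q[unfolded PQ] P[unfolded PQ] ne(2) l'] PQ
    by (simp add: algebra_simps)
qed

text \<open>
  The slope joining \<open>- P\<close> to \<open>P + Q\<close> is minus the slope joining \<open>P\<close> to \<open>Q\<close>. The formula breaks down only
  if \<open>P + Q = P\<close> with \<open>Q\<close> affine, and then the chord conditions make \<open>P\<close> a singular point. This is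
  where the discriminant enters the group law.
\<close>
lemma ec_add_cancel:
  fixes a b :: "'a::field_char_0"
  assumes disc: "4 * a ^ 3 + 27 * b ^ 2 \<noteq> 0"
    and P: "on_curve a b P" and Q: "on_curve a b Q"
  shows "ec_add a (ec_neg P) (ec_add a P Q) = Q"
proof (cases "P = Infinity \<or> Q = Infinity \<or> Q = ec_neg P")
  case True
  then show ?thesis
    using ec_add_neg[of a P] ec_add_neg[of a "ec_neg P"] by (cases P; cases Q) (auto simp: ec_neg_neg)
next
  case False
  then obtain x1 y1 x2 y2 where PQ: "P = Affine x1 y1" "Q = Affine x2 y2"
    by (cases P; cases Q) auto
  have ne: "\<not> (x1 = x2 \<and> y1 = - y2)" using False PQ by auto
  have e1: "y1 ^ 2 = x1 ^ 3 + a * x1 + b" and e2: "y2 ^ 2 = x2 ^ 3 + a * x2 + b"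
    using P Q PQ by auto
  obtain l where l: "chord_slope a x1 y1 x2 y2 l"
    using chord_slope_exists ne(1) P Q PQ by blast
  define x3 y3 where "x3 = l ^ 2 - x1 - x2" and "y3 = l * (x1 - x3) - y1"
  have R: "ec_add a P Q = Affine x3 y3"
    using ec_add_chord[OF P[unfolded PQ] Q[unfolded PQ] ne(1) l] PQ by (simp add: x3_def y3_def)
  have on: "on_curve a b (Affine x3 y3)" "on_curve a b (Affine x1 (- y1))"
    using on_curve_add[OF P Q] R P PQ by auto
  have l': "chord_slope a x1 (- y1) x3 y3 (- l)"
    using l e1 unfolding chord_slope_def x3_def y3_def by algebra
  have "\<not> (x1 = x3 \<and> - y1 = - y3)"
  proof
    assume eq: "x1 = x3 \<and> - y1 = - y3"
    then have "2 * y1 = 0" using y3_def by simp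
    then have y1: "y1 = 0" by simp
    have "x1 \<noteq> x2" using ne y1 same_x_cases[of a b x1 y1 y2] P Q PQ by auto
    moreover have "(x2 - x1) * (3 * x1 ^ 2 + a) = 0"
      using eq y1 l e1 e2 unfolding chord_slope_def x3_def by algebra
    ultimately have "3 * x1 ^ 2 + a = 0" by simp
    then have "4 * a ^ 3 + 27 * b ^ 2 = 0" using e1 y1 by algebra
    then show False using disc by simp
  qed
  from ec_add_chord[OF on(2,1) this l']
  have "ec_add a (Affine x1 (- y1)) (Affine x3 y3) =
    Affine (l ^ 2 - x1 - x3) (- l * (x1 - (l ^ 2 - x1 - x3)) + y1)" by simp
  moreover have "l ^ 2 - x1 - x3 = x2" by (simp add: x3_def)
  moreover have "- l * (x1 - x2) + y1 = y2"
    using l unfolding chord_slope_def by algebra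
  ultimately show ?thesis using R PQ by simp
qed

text \<open>
  Let \<open>l\<close> and \<open>m\<close> be the slopes of \<open>AB\<close> and \<open>BC\<close>, and let \<open>k = (m - l) / (x3 - x1)\<close> be the second divided
  difference of \<open>y\<close>; it vanishes exactly if \<open>A\<close>, \<open>B\<close>, \<open>C\<close> are collinear. The key fact is that the line
  joining \<open>A + B\<close> to \<open>C\<close> has slope \<open>1 / k - l\<close>. Exchanging \<open>A\<close>
  and \<open>C\<close> swaps \<open>l\<close> and \<open>m\<close> but keeps \<open>k\<close>, and \<open>k (x3 - x1) = m - l\<close> turns the formula for \<open>(A + B) + C\<close> into
  the one for \<open>(C + B) + A\<close>; this is associativity in general position.
\<close>
lemma ec_add_third:
  fixes a b :: "'a::field_char_0"
  assumes e1: "on_curve a b (Affine x1 y1)" and e2: "on_curve a b (Affine x2 y2)"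
    and e3: "on_curve a b (Affine x3 y3)"
    and ne12: "\<not> (x1 = x2 \<and> y1 = - y2)" and ne23: "\<not> (x2 = x3 \<and> y2 = - y3)"
    and ne13: "x1 \<noteq> x3"
    and l: "chord_slope a x1 y1 x2 y2 l" and m: "chord_slope a x2 y2 x3 y3 m"
    and k: "k * (x3 - x1) = m - l"
  shows "ec_add a (ec_add a (Affine x1 y1) (Affine x2 y2)) (Affine x3 y3) =
    (if k = 0 then Infinity else
      let x = (1 / k - l) ^ 2 - l ^ 2 + x1 + x2 - x3
      in Affine x ((1 / k - l) * (x3 - x) - y3))"
proof -
  define x4 y4 where "x4 = l ^ 2 - x1 - x2" and "y4 = l * (x1 - x4) - y1"
  have D: "ec_add a (Affine x1 y1) (Affine x2 y2) = Affine x4 y4"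
    using ec_add_chord[OF e1 e2 ne12 l] by (simp add: x4_def y4_def)
  have on: "on_curve a b (Affine x4 y4)"
    using on_curve_add[OF e1 e2] D by simp
  have "(x3 - x1) * (x3 - x4) = (x3 - x1) * (k * (y2 + l * (x3 - x2) + y3))"
    using k l m unfolding chord_slope_def x4_def by algebra
  then have x34: "x3 - x4 = k * (y2 + l * (x3 - x2) + y3)" using ne13 by simp
  have y34: "y3 + y4 = (m - l) * (x3 - x2) + l * (x3 - x4)"
    using l m unfolding chord_slope_def y4_def by algebra
  show ?thesis
  proof (cases "k = 0")
    case True
    then have "x4 = x3" "y4 = - y3" using x34 y34 k by (simp_all add: eq_neg_iff_add_eq_0 add.commute)
    then show ?thesis using D True by simp
  next
    case False
    define l2 where "l2 = 1 / k - l"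
    have l2: "k * l2 = 1 - k * l" using False by (simp add: l2_def right_diff_distrib)
    \<comment> \<open>If \<open>A + B = - C\<close>, then \<open>C\<close> is on the line \<open>AB\<close>, which \<open>k \<noteq> 0\<close> excludes.\<close>
    have ne: "\<not> (x4 = x3 \<and> y4 = - y3)"
    proof
      assume eq: "x4 = x3 \<and> y4 = - y3"
      then have h: "y2 + l * (x3 - x2) + y3 = 0" using x34 False by simp
      have "(m - l) * (x3 - x2) = 0" using y34 eq by simp
      moreover have "m - l \<noteq> 0" using k False ne13 by auto
      ultimately have "x3 = x2" by simp
      then show False using h ne23 by (simp add: eq_neg_iff_add_eq_0)
    qed
    have "k * (l2 * (x3 - x4)) = k * (y3 - y4)"
      using l2 x34 y34 l m k unfolding chord_slope_def x4_def y4_def by algebra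
    then have s1: "l2 * (x3 - x4) = y3 - y4" using False by simp
    have "(1 - k * l) * ((x3 - x1) * (x3 - x2) + l * (y2 + l * (x3 - x2) + y3))
        = x4 ^ 2 + x4 * x3 + x3 ^ 2 + a"
      using x34 k l m unfolding chord_slope_def x4_def by algebra
    moreover have "y3 + y4 = k * ((x3 - x1) * (x3 - x2) + l * (y2 + l * (x3 - x2) + y3))"
      using y34 x34 k by algebra
    ultimately have "k * (l2 * (y4 + y3)) = k * (x4 ^ 2 + x4 * x3 + x3 ^ 2 + a)"
      using l2 by algebra
    then have s2: "l2 * (y4 + y3) = x4 ^ 2 + x4 * x3 + x3 ^ 2 + a" using False by simp
    have "chord_slope a x4 y4 x3 y3 l2" using s1 s2 by (simp add: chord_slope_def)
    from ec_add_chord[OF on e3 ne this] have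
      E: "ec_add a (Affine x4 y4) (Affine x3 y3) = Affine (l2 ^ 2 - x4 - x3) (l2 * (x4 - (l2 ^ 2 - x4 - x3)) - y4)" .
    moreover have "l2 ^ 2 - x4 - x3 = l2 ^ 2 - l ^ 2 + x1 + x2 - x3" by (simp add: x4_def)
    moreover have "l2 * (x4 - X) - y4 = l2 * (x3 - X) - y3" for X
      using s1 by (simp add: algebra_simps)
    ultimately have "ec_add a (Affine x4 y4) (Affine x3 y3) =
        (let x = l2 ^ 2 - l ^ 2 + x1 + x2 - x3 in Affine x (l2 * (x3 - x) - y3))"
      by (simp only: Let_def)
    then show ?thesis using D False by (simp only: l2_def if_False)
  qed
qed

text \<open>
  The case of \<open>x1 = x3\<close> that the formula above leaves out is harmless: \<open>R = P\<close> follows from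
  commutativity and \<open>R = - P\<close> from cancellation.
\<close>
lemma ec_add_assoc:
  fixes a b :: "'a::field_char_0"
  assumes disc: "4 * a ^ 3 + 27 * b ^ 2 \<noteq> 0"
    and P: "on_curve a b P" and Q: "on_curve a b Q" and R: "on_curve a b R"
  shows "ec_add a (ec_add a P Q) R = ec_add a P (ec_add a Q R)"
proof -
  note comm = ec_add_commute[of a b]
  have neg_left: "ec_add a (ec_neg P) P = Infinity" for P :: "'a ec_point"
    using ec_add_neg[of a "ec_neg P"] by (simp add: ec_neg_neg)
  have zero: "ec_add a P Infinity = P" for P :: "'a ec_point"
    by (cases P) auto
  consider "P = Infinity \<or> Q = Infinity \<or> R = Infinity" | "R = P" | "R = ec_neg P"
    | "Q = ec_neg P" | "R = ec_neg Q"
    | "P \<noteq> Infinity" "Q \<noteq> Infinity" "R \<noteq> Infinity"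
      "R \<noteq> P" "R \<noteq> ec_neg P" "Q \<noteq> ec_neg P" "R \<noteq> ec_neg Q"
    by blast
  then show ?thesis
  proof cases
    case 1
    then show ?thesis by (auto simp: zero)
  next
    case 2
    then show ?thesis using comm P Q on_curve_add by metis
  next
    case 3
    then show ?thesis
      using ec_add_cancel[OF disc P Q] ec_add_cancel[OF disc, of "ec_neg P" Q] comm P Q on_curve_add
        on_curve_neg ec_neg_neg by metis
  next
    case 4
    then show ?thesis
      using ec_add_cancel[OF disc, of "ec_neg P" R] P R
      by (simp add: on_curve_neg ec_neg_neg ec_add_neg)
  next
    case 5
    then show ?thesis
      using ec_add_cancel[OF disc Q P] comm P Q on_curve_add ec_add_neg zero on_curve_neg by metis
  next
    case 6
    then obtain x1 y1 x2 y2 x3 y3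
      where PQR: "P = Affine x1 y1" "Q = Affine x2 y2" "R = Affine x3 y3"
      by (cases P; cases Q; cases R) auto
    note on = P[unfolded PQR] Q[unfolded PQR] R[unfolded PQR]
    have ne12: "\<not> (x1 = x2 \<and> y1 = - y2)" "\<not> (x2 = x1 \<and> y2 = - y1)"
      and ne23: "\<not> (x2 = x3 \<and> y2 = - y3)" "\<not> (x3 = x2 \<and> y3 = - y2)"
      using 6 PQR by auto
    have ne13: "x1 \<noteq> x3"
      using 6 PQR same_x_cases[of a b x1 y1 y3] on by auto
    obtain l m where lm: "chord_slope a x1 y1 x2 y2 l" "chord_slope a x2 y2 x3 y3 m"
      using chord_slope_exists on ne12 ne23 by blast
    then have lm': "chord_slope a x2 y2 x1 y1 l" "chord_slope a x3 y3 x2 y2 m"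
      unfolding chord_slope_def by algebra+
    define k where "k = (m - l) / (x3 - x1)"
    have k: "k * (x3 - x1) = m - l" "k * (x1 - x3) = l - m"
      using ne13 by (simp_all add: k_def field_simps)
    have L: "ec_add a (ec_add a P Q) R = (if k = 0 then Infinity else
      let x = (1 / k - l) ^ 2 - l ^ 2 + x1 + x2 - x3 in Affine x ((1 / k - l) * (x3 - x) - y3))"
      using ec_add_third[OF on ne12(1) ne23(1) ne13 lm k(1)] PQR by simp
    have "ec_add a P (ec_add a Q R) = ec_add a (ec_add a R Q) P"
      using comm on_curve_add P Q R by metis
    also have "\<dots> = (if k = 0 then Infinity else
      let x = (1 / k - m) ^ 2 - m ^ 2 + x3 + x2 - x1 in Affine x ((1 / k - m) * (x1 - x) - y1))"
      using ec_add_third[OF on(3,2,1) ne23(2) ne12(2) ne13[symmetric] lm'(2,1) k(2)] PQR by simp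
    also have "\<dots> = ec_add a (ec_add a P Q) R"
    proof (cases "k = 0")
      case False
      define i where "i = 1 / k"
      have i: "k * i = 1" using False by (simp add: i_def)
      have x: "(i - l) ^ 2 - l ^ 2 + x1 + x2 - x3 = (i - m) ^ 2 - m ^ 2 + x3 + x2 - x1"
        using i k(1) by algebra
      have "(i - l) * (x3 - X) - y3 = (i - m) * (x1 - X) - y1"
        if "X = (i - l) ^ 2 - l ^ 2 + x1 + x2 - x3" for X
        using that i k(1) lm unfolding chord_slope_def by algebra
      then show ?thesis unfolding L i_def[symmetric] Let_def x by simp
    qed (simp add: L)
    finally show ?thesis ..
  qed
qed

lemma ec_group_is_group:
  fixes a b :: "'a::field_char_0"
  assumes "4 * a ^ 3 + 27 * b ^ 2 \<noteq> 0"
  shows "group (ec_group a b)"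
proof (rule groupI)
  fix P assume "P \<in> carrier (ec_group a b)"
  then have "ec_neg P \<in> carrier (ec_group a b)" "ec_neg P \<otimes>\<^bsub>ec_group a b\<^esub> P = \<one>\<^bsub>ec_group a b\<^esub>"
    using ec_add_neg[of a "ec_neg P"] by (simp_all add: ec_group_def on_curve_neg ec_neg_neg)
  then show "\<exists>Q \<in> carrier (ec_group a b). Q \<otimes>\<^bsub>ec_group a b\<^esub> P = \<one>\<^bsub>ec_group a b\<^esub>" ..
qed (use assms in \<open>auto simp: ec_group_def on_curve_add ec_add_assoc\<close>)

section \<open>Finite sets closed under duplication\<close>

lemma ec_double_x:
  fixes a b :: "'a::field_char_0"
  assumes P: "on_curve a b (Affine x y)" and y: "y \<noteq> 0"
  obtains u v where "ec_add a (Affine x y) (Affine x y) = Affine u v"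
    "4 * (x ^ 3 + a * x + b) * u = (x ^ 2 + a) ^ 2 - 4 * a * x ^ 2 - 8 * b * x"
proof -
  have ne: "\<not> (x = x \<and> y = - y)" using y by simp
  obtain l where l: "chord_slope a x y x y l"
    using chord_slope_exists[OF P P ne] by blast
  have "4 * (x ^ 3 + a * x + b) * (l ^ 2 - x - x) = (x ^ 2 + a) ^ 2 - 4 * a * x ^ 2 - 8 * b * x"
    using l P unfolding chord_slope_def on_curve.simps by algebra
  with ec_add_chord[OF P P ne l] that show thesis by blast
qed

text \<open>
  All that is retained of torsion is a condition on \<open>x\<close>-coordinates: a set that contains \<open>x(2P)\<close> whenever
  it contains \<open>x(P)\<close>, unless \<open>2P\<close> is the point at infinity. The duplication formula is stated without
  division so that it can be used in polynomial identities.
\<close>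
definition doubling_closed :: "'a::field \<Rightarrow> 'a \<Rightarrow> 'a set \<Rightarrow> bool" where
  "doubling_closed a b S \<longleftrightarrow> (\<forall>x \<in> S. x ^ 3 + a * x + b \<noteq> 0 \<longrightarrow>
     (\<exists>u \<in> S. 4 * (x ^ 3 + a * x + b) * u = (x ^ 2 + a) ^ 2 - 4 * a * x ^ 2 - 8 * b * x))"

lemma doubling_closed_Un:
  "doubling_closed a b S \<Longrightarrow> doubling_closed a b T \<Longrightarrow> doubling_closed a b (S \<union> T)"
  unfolding doubling_closed_def by blast

text \<open>The witness is the set of \<open>x\<close>-coordinates of the multiples of the point.\<close>
lemma torsion_imp_finite_doubling_closed:
  fixes a b :: "'a::field_char_0"
  assumes disc: "4 * a ^ 3 + 27 * b ^ 2 \<noteq> 0" and tor: "ec_torsion a b (Affine x y)"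
  obtains S where "finite S" "doubling_closed a b S" "x \<in> S"
proof -
  interpret group "ec_group a b" by (rule ec_group_is_group[OF disc])
  define P where "P = Affine x y"
  have P: "P \<in> carrier (ec_group a b)" using tor by (simp add: ec_torsion_def P_def)
  obtain n :: nat where n: "n > 0" "P [^]\<^bsub>ec_group a b\<^esub> n = \<one>\<^bsub>ec_group a b\<^esub>"
    using tor by (auto simp: ec_torsion_def P_def)
  define M where "M = range (\<lambda>k::nat. P [^]\<^bsub>ec_group a b\<^esub> k)"
  have mod_n: "P [^]\<^bsub>ec_group a b\<^esub> k = P [^]\<^bsub>ec_group a b\<^esub> (k mod n)" for k
  proof -
    have "P [^]\<^bsub>ec_group a b\<^esub> k = P [^]\<^bsub>ec_group a b\<^esub> (n * (k div n) + k mod n)" by simp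
    also have "\<dots> = P [^]\<^bsub>ec_group a b\<^esub> (k mod n)"
      using P n by (simp only: nat_pow_mult[OF P, symmetric] nat_pow_pow[OF P, symmetric]) simp
    finally show ?thesis .
  qed
  have "M \<subseteq> (\<lambda>k. P [^]\<^bsub>ec_group a b\<^esub> k) ` {..<n}"
    unfolding M_def using mod_n n(1) by (metis (no_types, lifting) image_subsetI imageI lessThan_iff mod_less_divisor)
  then have fin: "finite M" by (rule finite_subset) simp
  define S where "S = {u. \<exists>v. Affine u v \<in> M}"
  have "S \<subseteq> (\<lambda>Q. case Q of Infinity \<Rightarrow> 0 | Affine u v \<Rightarrow> u) ` M"
    unfolding S_def by (force split: ec_point.splits)
  then have "finite S" using fin by (blast intro: finite_subset)
  moreover have "x \<in> S"
  proof -
    have "P = P [^]\<^bsub>ec_group a b\<^esub> (1::nat)" using P by simp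
    then show ?thesis unfolding S_def M_def P_def by blast
  qed
  moreover have "doubling_closed a b S"
    unfolding doubling_closed_def
  proof (intro ballI impI)
    fix u assume "u \<in> S" and nz: "u ^ 3 + a * u + b \<noteq> 0"
    then obtain v k where k: "Affine u v = P [^]\<^bsub>ec_group a b\<^esub> (k::nat)"
      unfolding S_def M_def by blast
    have on: "on_curve a b (Affine u v)"
      using nat_pow_closed[OF P, of k] unfolding k[symmetric] by (simp add: ec_group_def)
    then have "v \<noteq> 0" using nz by auto
    then obtain u' v' where *: "ec_add a (Affine u v) (Affine u v) = Affine u' v'"
      "4 * (u ^ 3 + a * u + b) * u' = (u ^ 2 + a) ^ 2 - 4 * a * u ^ 2 - 8 * b * u"
      using ec_double_x[OF on] by blast
    have "Affine u' v' = P [^]\<^bsub>ec_group a b\<^esub> (k + k)"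
      unfolding *(1)[symmetric] nat_pow_mult[OF P, symmetric] k[symmetric] by (simp add: ec_group_def)
    then have "u' \<in> S" unfolding S_def M_def by blast
    with *(2) show "\<exists>u'\<in>S. 4 * (u ^ 3 + a * u + b) * u' = (u ^ 2 + a) ^ 2 - 4 * a * u ^ 2 - 8 * b * u"
      by blast
  qed
  ultimately show thesis using that by blast
qed

section \<open>Valuation rings\<close>

locale subring_of_field =
  fixes A :: "'a::field set"
  assumes one_mem: "1 \<in> A"
    and diff_mem: "x \<in> A \<Longrightarrow> y \<in> A \<Longrightarrow> x - y \<in> A"
    and mult_mem: "x \<in> A \<Longrightarrow> y \<in> A \<Longrightarrow> x * y \<in> A"
begin

lemma zero_mem: "0 \<in> A" using diff_mem[OF one_mem one_mem] by simp
lemma uminus_mem: "x \<in> A \<Longrightarrow> - x \<in> A" using diff_mem[OF zero_mem] by simp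
lemma add_mem: "x \<in> A \<Longrightarrow> y \<in> A \<Longrightarrow> x + y \<in> A"
  using diff_mem[OF _ uminus_mem, of x y] by simp
lemma power_mem: "x \<in> A \<Longrightarrow> x ^ n \<in> A"
  by (induction n) (auto intro: one_mem mult_mem)
lemma of_nat_mem: "of_nat n \<in> A"
  by (induction n) (auto intro: zero_mem one_mem add_mem)
lemma numeral_mem: "numeral k \<in> A"
  using of_nat_mem[of "numeral k"] by simp
lemma sum_mem: "(\<And>i. i \<in> I \<Longrightarrow> g i \<in> A) \<Longrightarrow> sum g I \<in> A"
  by (induction I rule: infinite_finite_induct) (auto intro: zero_mem add_mem)

lemmas mem = zero_mem one_mem add_mem diff_mem uminus_mem mult_mem power_mem numeral_mem

definition adjoin :: "'a \<Rightarrow> 'a set" where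
  "adjoin x = {poly p x | p. \<forall>i. coeff p i \<in> A}"

lemma subring_adjoin: "subring_of_field (adjoin x)"
proof
  show "1 \<in> adjoin x"
    unfolding adjoin_def by (rule CollectI, rule exI[of _ 1]) (auto simp: zero_mem one_mem)
next
  fix u v assume "u \<in> adjoin x" "v \<in> adjoin x"
  then obtain p q where pq: "u = poly p x" "v = poly q x" "\<And>i. coeff p i \<in> A" "\<And>i. coeff q i \<in> A"
    unfolding adjoin_def by blast
  have "u - v = poly (p - q) x" "\<And>i. coeff (p - q) i \<in> A"
    using pq by (auto intro: diff_mem)
  then show "u - v \<in> adjoin x" unfolding adjoin_def by blast
  have "u * v = poly (p * q) x" "\<And>i. coeff (p * q) i \<in> A"
    using pq by (auto simp: coeff_mult intro: sum_mem mult_mem)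
  then show "u * v \<in> adjoin x" unfolding adjoin_def by blast
qed

lemma subset_adjoin: "A \<subseteq> adjoin x"
proof
  fix c assume "c \<in> A"
  then have "c = poly [:c:] x" "\<And>i. coeff [:c:] i \<in> A"
    by (auto simp: coeff_pCons zero_mem split: nat.splits)
  then show "c \<in> adjoin x" unfolding adjoin_def by blast
qed

lemma mem_adjoin: "x \<in> adjoin x"
proof -
  have "x = poly [:0, 1:] x" "\<And>i. coeff [:0, 1:] i \<in> A"
    by (auto simp: coeff_pCons zero_mem one_mem split: nat.splits)
  then show ?thesis unfolding adjoin_def by blast
qed

end

locale valuation_ring = subring_of_field +
  assumes total: "x \<in> A \<or> inverse x \<in> A"

text \<open>
  The degree reduction in Chevalley's extension theorem. Suppose \<open>1\<close> is a value at \<open>x\<close> of a polynomial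
  \<open>p\<close> with coefficients in the ideal \<open>tA\<close>, and also a value at \<open>1 / x\<close> of such a polynomial \<open>q\<close> of no larger
  degree. As \<open>1 - q(0)\<close> is a unit, the second relation expresses a power of \<open>x\<close> by lower powers, which
  serves to remove the leading term of \<open>p\<close>.
\<close>
lemma (in subring_of_field) reduce_degree:
  assumes t: "t \<in> A"
    and units: "\<And>c. c \<in> A \<Longrightarrow> inverse (1 - t * c) \<in> A" "\<And>c. c \<in> A \<Longrightarrow> t * c \<noteq> 1"
    and x: "x \<noteq> 0"
    and p: "poly p x = 1" "\<And>i. coeff p i \<in> (*) t ` A"
    and q: "poly q (inverse x) = 1" "\<And>i. coeff q i \<in> (*) t ` A"
    and le: "degree q \<le> degree p"
  obtains p' where "poly p' x = 1" "\<And>i. coeff p' i \<in> (*) t ` A" "degree p' < degree p"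
proof -
  define n m where "n = degree p" and "m = degree q"
  have ideal_mult: "u * c \<in> (*) t ` A" if "u \<in> (*) t ` A" "c \<in> A" for u c
    using that by (auto simp: mult.assoc intro: mult_mem)
  have ideal_add: "u + v \<in> (*) t ` A" "u - v \<in> (*) t ` A"
    if uv: "u \<in> (*) t ` A" "v \<in> (*) t ` A" for u v
  proof -
    from uv obtain c d where "u = t * c" "v = t * d" "c \<in> A" "d \<in> A" by blast
    then have "u + v = t * (c + d)" "u - v = t * (c - d)" "c + d \<in> A" "c - d \<in> A"
      by (auto simp: algebra_simps intro: mem)
    then show "u + v \<in> (*) t ` A" "u - v \<in> (*) t ` A" by blast+
  qed
  have ideal_0: "0 \<in> (*) t ` A" using zero_mem by force
  have ideal_sum: "(\<And>i. i \<in> I \<Longrightarrow> g i \<in> (*) t ` A) \<Longrightarrow> sum g I \<in> (*) t ` A" for g and I :: "nat set"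
    by (induction I rule: infinite_finite_induct) (auto intro: ideal_0 ideal_add)
  obtain c0 where c0: "coeff q 0 = t * c0" "c0 \<in> A" using q(2) by blast
  define w where "w = inverse (1 - t * c0)"
  have w: "w \<in> A" "w * (1 - t * c0) = 1"
    using units[OF c0(2)] by (auto simp: w_def)
  have m: "m \<noteq> 0"
  proof
    assume "m = 0"
    then obtain c where "q = [:c:]" unfolding m_def by (metis degree_eq_zeroE)
    then show False using q(1) c0 units(2) by auto
  qed
  have sum_q: "1 = t * c0 + (\<Sum>j\<in>{1..m}. coeff q j * inverse x ^ j)"
  proof -
    have "1 = (\<Sum>j\<in>{0..m}. coeff q j * inverse x ^ j)"
      using q(1) by (simp add: poly_altdef m_def atMost_atLeast0)
    also have "{0..m} = insert 0 {1..m}" by auto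
    finally show ?thesis using c0 by simp
  qed
  define r where "r = (\<Sum>j\<in>{1..m}. monom (coeff q j * w) (n - j))"
  have rc: "coeff r i \<in> (*) t ` A" for i
    unfolding r_def coeff_sum using q(2) w(1)
    by (intro ideal_sum) (auto simp: coeff_monom intro: ideal_0 ideal_mult)
  have rd: "degree r < n"
  proof -
    have "degree r \<le> n - 1"
      unfolding r_def
      by (rule degree_sum_le) (auto intro!: order_trans[OF degree_monom_le])
    then show ?thesis using m le unfolding n_def m_def by linarith
  qed
  have rx: "poly r x = x ^ n"
  proof -
    have "poly r x = (\<Sum>j\<in>{1..m}. coeff q j * w * x ^ (n - j))"
      unfolding r_def by (simp add: poly_sum poly_monom)
    also have "\<dots> = (\<Sum>j\<in>{1..m}. x ^ n * (w * (coeff q j * inverse x ^ j)))"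
    proof (rule sum.cong)
      fix j assume "j \<in> {1..m}"
      then have "j \<le> n" using le by (simp add: n_def m_def)
      then have "x ^ (n - j) = x ^ n * inverse x ^ j"
        using x by (simp add: power_diff field_simps)
      then show "coeff q j * w * x ^ (n - j) = x ^ n * (w * (coeff q j * inverse x ^ j))"
        by simp
    qed simp
    also have "\<dots> = x ^ n * (w * (1 - t * c0))"
      using sum_q by (simp add: sum_distrib_left[symmetric] eq_diff_eq add.commute)
    finally show ?thesis using w(2) by simp
  qed
  define p' where "p' = p - monom (coeff p n) n + smult (coeff p n) r"
  have "poly p' x = 1"
    unfolding p'_def using p(1) rx by (simp add: poly_monom)
  moreover have "coeff p' i \<in> (*) t ` A" for i
  proof -
    obtain c where c: "c \<in> A" "coeff p n = t * c" using p(2) by blast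
    have "coeff r i * coeff p n \<in> (*) t ` A"
      using rc c t by (intro ideal_mult) (auto intro: mem)
    moreover have "coeff p i - (if n = i then coeff p n else 0) \<in> (*) t ` A"
      using p(2) ideal_add(2) ideal_0 by (cases "n = i") simp_all
    ultimately have "coeff p i - (if n = i then coeff p n else 0) + coeff r i * coeff p n \<in> (*) t ` A"
      using ideal_add(1) by blast
    then show ?thesis
      unfolding p'_def by (simp only: coeff_add coeff_diff coeff_monom coeff_smult mult.commute[of "coeff p n"])
  qed
  moreover have "degree p' < degree p"
  proof -
    have n0: "n > 0" using m le unfolding n_def m_def by linarith
    have "degree (p - monom (coeff p n) n) \<le> n - 1"
    proof (rule degree_le, intro allI impI)
      fix i assume "n - 1 < i"
      then consider "i = n" | "i > n" by linarith
      then show "coeff (p - monom (coeff p n) n) i = 0"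
        by cases (auto simp: coeff_monom n_def coeff_eq_0)
    qed
    moreover have "degree (smult (coeff p n) r) \<le> n - 1"
      using rd n0 degree_smult_le[of "coeff p n" r] by linarith
    ultimately have "degree p' \<le> n - 1"
      unfolding p'_def by (rule degree_add_le)
    then show ?thesis using n0 by (simp add: n_def)
  qed
  ultimately show thesis using that by blast
qed

lemma (in subring_of_field) adjoin_inverse_relation:
  assumes t: "t \<noteq> 0" and "inverse t \<in> adjoin x"
  obtains p where "poly p x = 1" "\<And>i. coeff p i \<in> (*) t ` A"
proof -
  obtain p where p: "inverse t = poly p x" "\<And>i. coeff p i \<in> A"
    using assms(2) unfolding adjoin_def by blast
  show thesis
    by (rule that[of "smult t p"]) (use p t in \<open>auto simp flip: p(1)\<close>)
qed

text \<open>
  A subring that is maximal among those which contain \<open>A\<close> but not \<open>1 / t\<close> is a valuation ring: if both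
  \<open>x\<close> and \<open>1 / x\<close> were outside, adjoining either of them would produce \<open>1 / t\<close>, that is, a relation as
  above for \<open>x\<close> and one for \<open>1 / x\<close>, and the one of larger degree could always be shortened.
\<close>
theorem (in subring_of_field) valuation_ring_extension:
  assumes t: "t \<in> A" "t \<noteq> 0" "inverse t \<notin> A"
  obtains B where "A \<subseteq> B" "valuation_ring B" "inverse t \<notin> B"
proof -
  define F where "F = {B. subring_of_field B \<and> A \<subseteq> B \<and> inverse t \<notin> B}"
  have "\<exists>B\<in>F. \<forall>X\<in>F. B \<subseteq> X \<longrightarrow> X = B"
  proof (rule subset_Zorn_nonempty)
    show "F \<noteq> {}" using subring_of_field_axioms t(3) by (auto simp: F_def)
  next
    fix C assume C: "C \<noteq> {}" "subset.chain F C"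
    then have sub: "subring_of_field X" "A \<subseteq> X" "inverse t \<notin> X" if "X \<in> C" for X
      using that by (auto simp: F_def subset.chain_def)
    have common: "\<exists>X\<in>C. u \<in> X \<and> v \<in> X" if "u \<in> \<Union>C" "v \<in> \<Union>C" for u v
    proof -
      from that obtain X Y where XY: "u \<in> X" "X \<in> C" "v \<in> Y" "Y \<in> C" by blast
      then have "X \<subseteq> Y \<or> Y \<subseteq> X" using C(2) unfolding subset.chain_def by blast
      then show ?thesis using XY by blast
    qed
    have "subring_of_field (\<Union>C)"
    proof
      show "1 \<in> \<Union>C" using C(1) sub(1) subring_of_field.one_mem by blast
    next
      fix u v assume "u \<in> \<Union>C" "v \<in> \<Union>C"
      then obtain X where X: "X \<in> C" "u \<in> X" "v \<in> X" using common by blast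
      then interpret X: subring_of_field X using sub(1) by blast
      show "u - v \<in> \<Union>C" "u * v \<in> \<Union>C" using X X.diff_mem X.mult_mem by blast+
    qed
    moreover have "A \<subseteq> \<Union>C" using sub(2) C(1) by blast
    ultimately show "\<Union>C \<in> F" using sub(3) by (auto simp: F_def)
  qed
  then obtain B where B: "B \<in> F" "\<And>X. X \<in> F \<Longrightarrow> B \<subseteq> X \<Longrightarrow> X = B" by blast
  interpret B: subring_of_field B using B(1) by (simp add: F_def)
  have tB: "t \<in> B" "inverse t \<notin> B" using B(1) t(1) by (auto simp: F_def)
  have adjoin: "inverse t \<in> B.adjoin x" if "x \<notin> B" for x
  proof (rule ccontr)
    assume "inverse t \<notin> B.adjoin x"
    then have "B.adjoin x \<in> F"
      using B.subring_adjoin B.subset_adjoin B(1) by (auto simp: F_def)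
    then have "B.adjoin x = B" using B(2) B.subset_adjoin by blast
    then show False using B.mem_adjoin that by blast
  qed
  have ne: "t * c \<noteq> 1" if "c \<in> B" for c
    using that tB t(2) by (metis inverse_unique)
  \<comment> \<open>Otherwise a power of \<open>d = 1 - t c\<close> lies in \<open>tB\<close>; but every power of \<open>d\<close> is \<open>1\<close> modulo \<open>t\<close>.\<close>
  have unit: "inverse (1 - t * c) \<in> B" if c: "c \<in> B" for c
  proof (rule ccontr)
    define d where "d = 1 - t * c"
    have d: "d \<in> B" "d \<noteq> 0" using c tB ne[OF c] by (auto simp: d_def intro: B.mem)
    assume "inverse (1 - t * c) \<notin> B"
    then obtain p where p: "poly p (inverse d) = 1" "\<And>i. coeff p i \<in> (*) t ` B"
      using B.adjoin_inverse_relation[OF t(2) adjoin] unfolding d_def by blast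
    define n where "n = degree p"
    have "d ^ n \<in> (*) t ` B"
    proof -
      have "d ^ n = d ^ n * poly p (inverse d)" using p by simp
      also have "\<dots> = (\<Sum>i\<le>n. coeff p i * d ^ (n - i))"
        unfolding poly_altdef n_def[symmetric] sum_distrib_left
        using d(2) by (intro sum.cong) (auto simp: power_diff field_simps)
      also have "\<dots> = t * (\<Sum>i\<le>n. coeff p i / t * d ^ (n - i))"
        using t(2) by (simp add: sum_distrib_left)
      finally have "d ^ n = t * (\<Sum>i\<le>n. coeff p i / t * d ^ (n - i))" .
      moreover have "coeff p i / t \<in> B" for i
        using p(2)[of i] t(2) by auto
      then have "(\<Sum>i\<le>n. coeff p i / t * d ^ (n - i)) \<in> B"
        using d(1) by (intro B.sum_mem B.mem)
      ultimately show ?thesis by blast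
    qed
    moreover have "\<exists>e\<in>B. d ^ n = 1 - t * e" for n
    proof (induction n)
      case 0
      then show ?case using B.zero_mem by force
    next
      case (Suc n)
      then obtain e where e: "e \<in> B" "d ^ n = 1 - t * e" by blast
      have "d ^ Suc n = 1 - t * (c + e - t * c * e)"
        unfolding power_Suc e(2) unfolding d_def by algebra
      moreover have "c + e - t * c * e \<in> B" using c e tB by (intro B.mem)
      ultimately show ?case by blast
    qed
    ultimately obtain u e where "u \<in> B" "e \<in> B" "t * u = 1 - t * e" by (metis imageE)
    then have "t * (u + e) = 1" "u + e \<in> B" by (auto simp: algebra_simps intro: B.mem)
    then show False using ne by blast
  qed
  have "x \<in> B \<or> inverse x \<in> B" for x
  proof (rule ccontr)
    assume x: "\<not> (x \<in> B \<or> inverse x \<in> B)"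
    then have x0: "x \<noteq> 0" using B.zero_mem by auto
    define rel where "rel y p \<longleftrightarrow> poly p y = 1 \<and> (\<forall>i. coeff p i \<in> (*) t ` B)" for y :: 'a and p
    have ex: "\<exists>p. rel x p" "\<exists>p. rel (inverse x) p"
      using B.adjoin_inverse_relation[OF t(2) adjoin] x unfolding rel_def by metis+
    define p where "p = arg_min degree (rel x)"
    define q where "q = arg_min degree (rel (inverse x))"
    have p: "rel x p" "\<And>p'. rel x p' \<Longrightarrow> degree p \<le> degree p'"
      using ex(1) arg_min_nat_lemma[of "rel x" _ degree] unfolding p_def by blast+
    have q: "rel (inverse x) q" "\<And>q'. rel (inverse x) q' \<Longrightarrow> degree q \<le> degree q'"
      using ex(2) arg_min_nat_lemma[of "rel (inverse x)" _ degree] unfolding q_def by blast+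
    show False
    proof (cases "degree q \<le> degree p")
      case True
      obtain p' where "rel x p'" "degree p' < degree p"
        by (rule B.reduce_degree[OF tB(1) unit ne x0 _ _ _ _ True])
          (use p(1) q(1) in \<open>auto simp: rel_def\<close>)
      then show False using p(2) by force
    next
      case False
      obtain q' where "rel (inverse x) q'" "degree q' < degree q"
        by (rule B.reduce_degree[OF tB(1) unit ne, of "inverse x" q p])
          (use p(1) q(1) x0 False in \<open>auto simp: rel_def\<close>)
      then show False using q(2) by force
    qed
  qed
  then have "valuation_ring B"
    by (intro valuation_ring.intro valuation_ring_axioms.intro) (rule B.subring_of_field_axioms)
  then show thesis using that B(1) by (auto simp: F_def)
qed

context valuation_ring
begin

text \<open>
  \<open>unit\<close> and \<open>small\<close> stand for valuation zero and positive valuation. Working with them and with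
  membership in \<open>A\<close> avoids the value group, which need not be archimedean.
\<close>

definition unit :: "'a \<Rightarrow> bool" where
  "unit x \<longleftrightarrow> x \<noteq> 0 \<and> x \<in> A \<and> inverse x \<in> A"

definition small :: "'a \<Rightarrow> bool" where
  "small x \<longleftrightarrow> x = 0 \<or> inverse x \<notin> A"

lemma small_mem: "small x \<Longrightarrow> x \<in> A"
  using total zero_mem by (auto simp: small_def)

lemma unit_mem: "unit x \<Longrightarrow> x \<in> A"
  by (simp add: unit_def)

lemma unit_or_small: "x \<in> A \<Longrightarrow> unit x \<or> small x"
  by (auto simp: unit_def small_def)

lemma not_small_unit: "unit x \<Longrightarrow> \<not> small x"
  by (auto simp: unit_def small_def)

lemma unit_1: "unit 1"
  by (simp add: unit_def one_mem)

lemma small_0: "small 0"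
  by (simp add: small_def)

lemma small_inverse: "x \<notin> A \<Longrightarrow> small (inverse x)"
  by (simp add: small_def)

lemma unit_uminus: "unit x \<Longrightarrow> unit (- x)"
  by (simp add: unit_def uminus_mem)

lemma unit_mult: "unit x \<Longrightarrow> unit y \<Longrightarrow> unit (x * y)"
  by (auto simp: unit_def intro: mult_mem)

lemma small_mult: "small x \<Longrightarrow> y \<in> A \<Longrightarrow> small (x * y)"
  unfolding small_def using mult_mem[of y "inverse (x * y)"]
  by (auto simp: field_simps)

lemma small_mult': "x \<in> A \<Longrightarrow> small y \<Longrightarrow> small (x * y)"
  using small_mult[of y x] by (simp add: mult.commute)

lemma small_uminus: "small x \<Longrightarrow> small (- x)"
  using small_mult[of x "- 1"] by (simp add: one_mem uminus_mem)

lemma small_add: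
  assumes x: "small x" and y: "small y"
  shows "small (x + y)"
proof (cases "x = 0 \<or> y = 0")
  case False
  consider "x / y \<in> A" | "y / x \<in> A"
    using total[of "x / y"] by auto
  then show ?thesis
  proof cases
    case 1
    then have "small (y * (x / y + 1))" using y by (intro small_mult add_mem one_mem)
    then show ?thesis using False by (simp add: distrib_left)
  next
    case 2
    then have "small (x * (1 + y / x))" using x by (intro small_mult add_mem one_mem)
    then show ?thesis using False by (simp add: distrib_left)
  qed
qed (use x y in auto)

lemma small_diff: "small x \<Longrightarrow> small y \<Longrightarrow> small (x - y)"
  using small_add[of x "- y"] small_uminus[of y] by simp

lemma unit_add_small: "unit x \<Longrightarrow> small y \<Longrightarrow> unit (x + y)"
  using unit_or_small[of "x + y"] small_diff[of "x + y" y] not_small_unit[of x]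
  by (auto intro: add_mem unit_mem small_mem)

lemma unit_diff_small: "unit x \<Longrightarrow> small y \<Longrightarrow> unit (x - y)"
  using unit_add_small[of x "- y"] small_uminus[of y] by simp

lemma small_cancel_unit: "unit u \<Longrightarrow> small (u * x) \<Longrightarrow> small x"
  using small_mult[of "u * x" "inverse u"] by (auto simp: unit_def field_simps)

lemma mem_cancel_unit: "unit u \<Longrightarrow> u * x \<in> A \<Longrightarrow> x \<in> A"
  using mult_mem[of "inverse u" "u * x"] by (simp add: unit_def mult.assoc[symmetric])

lemma square_mem_imp_mem: "x ^ 2 \<in> A \<Longrightarrow> x \<in> A"
  using mult_mem[of "inverse x" "x ^ 2"] total[of x] zero_mem
  by (cases "x = 0") (auto simp: power2_eq_square mult.assoc[symmetric])

lemma small_square: "small (x ^ 2) \<Longrightarrow> small x"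
  using unit_or_small[OF square_mem_imp_mem[OF small_mem]] unit_mult[of x x] not_small_unit
  by (auto simp: power2_eq_square)

lemma exists_largest:
  assumes "finite X" "X \<noteq> {}" "0 \<notin> X"
  obtains x where "x \<in> X" "\<And>y. y \<in> X \<Longrightarrow> y * inverse x \<in> A"
proof -
  have "\<exists>x\<in>X. \<forall>y\<in>X. y * inverse x \<in> A"
    using assms
  proof (induction rule: finite_ne_induct)
    case (singleton x)
    then show ?case by (simp add: one_mem)
  next
    case (insert z X)
    then obtain x where x: "x \<in> X" "\<And>y. y \<in> X \<Longrightarrow> y * inverse x \<in> A" by auto
    have nz: "x \<noteq> 0" "z \<noteq> 0" using insert x by auto
    consider "z * inverse x \<in> A" | "x * inverse z \<in> A"
      using total[of "z * inverse x"] by (auto simp: mult.commute)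
    then show ?case
    proof cases
      case 1
      then show ?thesis using x by auto
    next
      case 2
      have "y * inverse z \<in> A" if "y \<in> X" for y
        using mult_mem[OF x(2)[OF that] 2] nz by (simp add: field_simps)
      then show ?thesis using nz one_mem by auto
    qed
  qed
  then show thesis using that by blast
qed

end

section \<open>Torsion abscissas at the prime 2\<close>

lemma cubic_factor:
  fixes e f g :: "'a::field_char_0"
  assumes "e + f + g = 0" "a = e * f + e * g + f * g" "b = - e * f * g"
  shows "x ^ 3 + a * x + b = (x - e) * (x - f) * (x - g)"
  using assms by algebra

text \<open>
  The numerator of \<open>x(2P) - e\<close> is a square because the function \<open>x - e\<close> has a double zero at the
  2-torsion point over \<open>e\<close>.
\<close>
lemma doubling_minus_root:
  fixes e f g :: "'a::field_char_0"
  assumes "e + f + g = 0" "a = e * f + e * g + f * g" "b = - e * f * g"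
    and "4 * ((u - e) * (u - f) * (u - g)) * w = (u ^ 2 + a) ^ 2 - 4 * a * u ^ 2 - 8 * b * u"
  shows "4 * ((u - e) * (u - f) * (u - g)) * (w - e) = ((u - e) ^ 2 - (e - f) * (e - g)) ^ 2"
  using assms by algebra

text \<open>
  The difference \<open>x(2P) - x(2Q)\<close> vanishes if \<open>P + Q\<close> or \<open>P - Q\<close> is a 2-torsion point. For the point at
  infinity this gives the factor \<open>u - v\<close>, for the point over \<open>e\<close> it gives
  \<open>(u - e) (v - e) - (e - f) (e - g)\<close>, because translation by that point sends \<open>u\<close> to
  \<open>e + (e - f) (e - g) / (u - e)\<close>.
\<close>
lemma doubling_difference:
  fixes e f g :: "'a::field_char_0"
  assumes "e + f + g = 0" "a = e * f + e * g + f * g" "b = - e * f * g"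
    and u: "4 * ((u - e) * (u - f) * (u - g)) * u' = (u ^ 2 + a) ^ 2 - 4 * a * u ^ 2 - 8 * b * u"
    and v: "4 * ((v - e) * (v - f) * (v - g)) * v' = (v ^ 2 + a) ^ 2 - 4 * a * v ^ 2 - 8 * b * v"
  shows "4 * ((u - e) * (u - f) * (u - g)) * ((v - e) * (v - f) * (v - g)) * (u' - v') =
     (u - v) * ((u - e) * (v - e) - (e - f) * (e - g))
       * ((u - f) * (v - f) - (f - e) * (f - g)) * ((u - g) * (v - g) - (g - e) * (g - f))"
proof -
  have g: "g = - e - f" using assms(1) by algebra
  have "(v - e) * (v - f) * (v - g) * ((u ^ 2 + a) ^ 2 - 4 * a * u ^ 2 - 8 * b * u)
      - (u - e) * (u - f) * (u - g) * ((v ^ 2 + a) ^ 2 - 4 * a * v ^ 2 - 8 * b * v)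
      = (u - v) * ((u - e) * (v - e) - (e - f) * (e - g))
       * ((u - f) * (v - f) - (f - e) * (f - g)) * ((u - g) * (v - g) - (g - e) * (g - f))"
    unfolding assms(2,3) g by algebra
  then show ?thesis using u v by algebra
qed

text \<open>
  The curve is scaled so that the largest difference of two of the roots \<open>e1\<close>, \<open>e2\<close>, \<open>e3\<close> of the
  cubic is a unit. At least two of the three differences are then units, and the labelling is chosen such that
  \<open>e3\<close> is apart from the other two roots. The set \<open>S\<close> plays the part of the \<open>x\<close>-coordinates of
  torsion points.
\<close>
locale dyadic_curve = valuation_ring A for A :: "'a::field_char_0 set" +
  fixes a b e1 e2 e3 :: 'a and S :: "'a set"
  assumes half: "inverse 2 \<notin> A"
    and sum_0: "e1 + e2 + e3 = 0"
    and a: "a = e1 * e2 + e1 * e3 + e2 * e3" and b: "b = - e1 * e2 * e3"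
    and diff_12: "e1 - e2 \<in> A" and unit_13: "unit (e1 - e3)" and unit_23: "unit (e2 - e3)"
    and fin: "finite S" and closed: "doubling_closed a b S"
begin

lemma small_2: "small 2"
  using half by (simp add: small_def)

lemma small_even: "x \<in> A \<Longrightarrow> small (2 * x)"
  by (rule small_mult[OF small_2])

lemma unit_odd: "x \<in> A \<Longrightarrow> unit (1 + 2 * x)"
  by (intro unit_add_small unit_1 small_even)

lemma root_mem: "e1 \<in> A" "e2 \<in> A" "e3 \<in> A"
proof -
  have u3: "unit 3" using unit_odd[OF one_mem] by simp
  have "3 * e3 = - (e1 - e3) - (e2 - e3)" using sum_0 by algebra
  then have "3 * e3 \<in> A" using unit_13 unit_23 by (simp only:) (intro mem unit_mem)
  then show e3: "e3 \<in> A" by (rule mem_cancel_unit[OF u3])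
  show "e1 \<in> A" using add_mem[OF unit_mem[OF unit_13] e3] by simp
  show "e2 \<in> A" using add_mem[OF unit_mem[OF unit_23] e3] by simp
qed

lemma a_mem: "a \<in> A" and b_mem: "b \<in> A"
  unfolding a b using root_mem by (auto intro!: mem)

lemma factor: "x ^ 3 + a * x + b = (x - e1) * (x - e2) * (x - e3)"
  by (rule cubic_factor[OF sum_0 a b])

lemma double:
  assumes "u \<in> S" "u \<notin> {e1, e2, e3}"
  obtains w where "w \<in> S"
    "4 * ((u - e1) * (u - e2) * (u - e3)) * w = (u ^ 2 + a) ^ 2 - 4 * a * u ^ 2 - 8 * b * u"
  using closed assms unfolding doubling_closed_def factor by auto

text \<open>
  If \<open>u\<close> is not integral, then the duplication formula is \<open>u / 4\<close> up to a unit, so \<open>x(2P)\<close> is strictly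
  larger than \<open>x(P)\<close>. A largest element of the finite set \<open>S\<close> is therefore integral.
\<close>
lemma integral: "S \<subseteq> A"
proof (rule ccontr)
  define T where "T = {u \<in> S. u \<notin> A}"
  assume "\<not> S \<subseteq> A"
  then have "finite T" "T \<noteq> {}" "0 \<notin> T"
    using fin zero_mem by (auto simp: T_def)
  then obtain u where u: "u \<in> T" "\<And>v. v \<in> T \<Longrightarrow> v * inverse u \<in> A"
    using exists_largest by blast
  have uS: "u \<in> S" "u \<notin> A" "u \<noteq> 0" using u(1) zero_mem by (auto simp: T_def)
  define s where "s = inverse u"
  have s: "small s" "s * u = 1" "s \<in> A"
    using uS small_inverse small_mem by (auto simp: s_def)
  have "u \<notin> {e1, e2, e3}" using uS root_mem by auto
  then obtain w where w: "w \<in> S"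
    "4 * ((u - e1) * (u - e2) * (u - e3)) * w = (u ^ 2 + a) ^ 2 - 4 * a * u ^ 2 - 8 * b * u"
    using double uS(1) by blast
  have eq: "4 * (w * s) * ((1 - s * e1) * (1 - s * e2) * (1 - s * e3))
      = (1 + s * (a * s)) ^ 2 - s * (4 * a * s + 8 * b * s ^ 2)"
    using w(2) s(2) by algebra
  have "unit ((1 + s * (a * s)) ^ 2)"
    unfolding power2_eq_square using a_mem s
    by (intro unit_mult unit_add_small unit_1 small_mult[OF s(1)] mem) auto
  then have R: "unit ((1 + s * (a * s)) ^ 2 - s * (4 * a * s + 8 * b * s ^ 2))"
    using a_mem b_mem s by (intro unit_diff_small small_mult[OF s(1)] mem)
  have "w * s \<in> A"
  proof (cases "w \<in> A")
    case True
    then show ?thesis using s(3) by (rule mult_mem)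
  next
    case False
    then show ?thesis using u(2) w(1) by (simp add: T_def s_def)
  qed
  then have "2 * (w * s) \<in> A" by (rule mult_mem[OF numeral_mem])
  moreover have "(1 - s * e1) * (1 - s * e2) * (1 - s * e3) \<in> A"
    using s(3) root_mem by (intro mem)
  ultimately have "small (2 * (2 * (w * s) * ((1 - s * e1) * (1 - s * e2) * (1 - s * e3))))"
    using small_even[OF mult_mem] by blast
  then have "small ((1 + s * (a * s)) ^ 2 - s * (4 * a * s + 8 * b * s ^ 2))"
    unfolding eq[symmetric] by (simp add: mult.assoc)
  then show False using R not_small_unit by blast
qed

text \<open>
  Integrality of \<open>x(2P)\<close> despite the denominator \<open>4\<close> forces the numerator, which is \<open>(u\<^sup>2 + a)\<^sup>2\<close>
  modulo \<open>4\<close>, to be divisible by \<open>4\<close>. So all elements of \<open>S\<close> apart from the roots reduce to the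
  square root of \<open>- a\<close> in the residue field, which is unique in characteristic two.
\<close>
lemma square_plus_a:
  assumes u: "u \<in> S" "u \<notin> {e1, e2, e3}"
  shows "(u ^ 2 + a) / 2 \<in> A"
proof -
  obtain w where w: "w \<in> S"
    "4 * ((u - e1) * (u - e2) * (u - e3)) * w = (u ^ 2 + a) ^ 2 - 4 * a * u ^ 2 - 8 * b * u"
    using double u by blast
  define h where "h = (u ^ 2 + a) / 2"
  have "u ^ 2 + a = 2 * h" by (simp add: h_def)
  with w(2) have "4 * h ^ 2 = 4 * (((u - e1) * (u - e2) * (u - e3)) * w + a * u ^ 2 + 2 * b * u)"
    by algebra
  then have "h ^ 2 = ((u - e1) * (u - e2) * (u - e3)) * w + a * u ^ 2 + 2 * b * u"
    by (simp only: mult_cancel_left) simp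
  moreover have "\<dots> \<in> A"
    using integral u(1) w(1) root_mem a_mem b_mem by (intro mem) auto
  ultimately show ?thesis using square_mem_imp_mem unfolding h_def by metis
qed

lemma square_plus_a_small:
  assumes u: "u \<in> S" "u \<notin> {e1, e2, e3}"
  shows "small (u ^ 2 + a)"
  using small_even[OF square_plus_a[OF u]] by (simp del: distrib_left_numeral)

text \<open>
  If \<open>e1\<close> and \<open>e2\<close> have the same reduction, then so has the square root of \<open>- a\<close>, while \<open>e3\<close> reduces to
  \<open>0\<close> because the roots sum to zero. Hence every element of \<open>S\<close> other than \<open>e3\<close> reduces to one and the
  same nonzero element.
\<close>
lemma coalescing_roots:
  assumes "small (e1 - e2)"
  shows "unit e1" and "\<And>u. u \<in> S \<Longrightarrow> u \<noteq> e3 \<Longrightarrow> small (u - e1)"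
proof -
  have "e3 = (e1 - e2) - 2 * e1" using sum_0 by algebra
  then have e3: "small e3" using assms small_even[OF root_mem(1)] small_diff by metis
  show "unit e1" using unit_add_small[OF unit_13 e3] by simp
  fix u assume u: "u \<in> S" "u \<noteq> e3"
  show "small (u - e1)"
  proof (cases "u \<in> {e1, e2}")
    case True
    then show ?thesis using small_0 small_uminus[OF assms] by auto
  next
    case False
    then have nr: "u \<notin> {e1, e2, e3}" using u by auto
    have "(u - e1) ^ 2 = (u ^ 2 + a) - 2 * (u * e1) + (e1 - e2) * e1 + e3 * e3"
      using sum_0 a by algebra
    moreover have "small \<dots>"
    proof (intro small_add[OF small_add[OF small_diff]])
      show "small (u ^ 2 + a)" by (rule square_plus_a_small[OF u(1) nr])
      show "small (2 * (u * e1))" using integral u(1) root_mem by (auto intro: small_even mult_mem)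
      show "small ((e1 - e2) * e1)" by (rule small_mult[OF assms root_mem(1)])
      show "small (e3 * e3)" by (rule small_mult[OF e3 root_mem(3)])
    qed
    ultimately show ?thesis using small_square by metis
  qed
qed

end

section \<open>Roots with distinct reductions\<close>

text \<open>
  The remaining case is that the three roots have distinct reductions. It cannot be excluded by
  reductions alone, but points of \<open>S\<close> cannot be too close to each other.
\<close>
locale separated_dyadic_curve = dyadic_curve +
  assumes unit_12: "unit (e1 - e2)"
begin

lemma unit_diff_commute: "unit (x - y) \<Longrightarrow> unit (y - x)"
  using unit_uminus[of "x - y"] by simp

lemma unit_root: "unit e1" "unit e2" "unit e3"
proof -
  have "(e3 - e2) - 2 * e3 = e1" "(e3 - e1) - 2 * e3 = e2" "(e2 - e1) - 2 * e2 = e3"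
    using sum_0 by algebra+
  then show "unit e1" "unit e2" "unit e3"
    using unit_diff_small[OF unit_diff_commute[OF unit_23] small_even[OF root_mem(3)]]
      unit_diff_small[OF unit_diff_commute[OF unit_13] small_even[OF root_mem(3)]]
      unit_diff_small[OF unit_diff_commute[OF unit_12] small_even[OF root_mem(2)]]
    by simp_all
qed

text \<open>The three roots play symmetric roles here; \<open>roots e f g\<close> lets a lemma single out any one of them.\<close>
definition roots :: "'a \<Rightarrow> 'a \<Rightarrow> 'a \<Rightarrow> bool" where
  "roots e f g \<longleftrightarrow> {e, f, g} = {e1, e2, e3} \<and> e + f + g = 0 \<and>
     a = e * f + e * g + f * g \<and> b = - e * f * g \<and>
     unit e \<and> unit f \<and> unit g \<and> unit (e - f) \<and> unit (e - g) \<and> unit (f - g)"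

lemma rootsD:
  assumes "roots e f g"
  shows "e + f + g = 0" "a = e * f + e * g + f * g" "b = - e * f * g"
    "unit e" "unit f" "unit g" "unit (e - f)" "unit (e - g)" "unit (f - g)"
    "{e, f, g} = {e1, e2, e3}"
  using assms unfolding roots_def by blast+

lemma roots_perm: "roots e1 e2 e3" "roots e2 e1 e3" "roots e3 e1 e2"
proof -
  note units = unit_root unit_12 unit_13 unit_23
  note units' = units unit_diff_commute[OF unit_12] unit_diff_commute[OF unit_13] unit_diff_commute[OF unit_23]
  have eqs: "e2 + e1 + e3 = 0" "e3 + e1 + e2 = 0"
    "a = e2 * e1 + e2 * e3 + e1 * e3" "a = e3 * e1 + e3 * e2 + e1 * e2"
    "b = - e2 * e1 * e3" "b = - e3 * e1 * e2"
    using sum_0 a b by algebra+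
  show "roots e1 e2 e3" "roots e2 e1 e3" "roots e3 e1 e2"
    unfolding roots_def by (intro conjI units' eqs sum_0 a b; blast)+
qed

lemma root_cases:
  assumes "e \<in> {e1, e2, e3}"
  obtains f g where "roots e f g"
  using assms roots_perm by blast

text \<open>
  If \<open>u\<close> reduced to \<open>e\<close>, then \<open>f g = e\<^sup>2 + a\<close> would be small together with \<open>u\<^sup>2 + a\<close>, but it is a
  unit.
\<close>
lemma unit_minus_root:
  assumes u: "u \<in> S" "u \<notin> {e1, e2, e3}" and e: "e \<in> {e1, e2, e3}"
  shows "unit (u - e)"
proof (rule ccontr)
  assume "\<not> unit (u - e)"
  moreover have "u - e \<in> A" using integral u(1) e root_mem by (auto intro: mem)
  ultimately have s: "small (u - e)" using unit_or_small by blast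
  obtain f g where r: "roots e f g" using root_cases[OF e] .
  have "f * g = (u ^ 2 + a) - (u - e) * (u - e) - 2 * (e * (u - e))"
    using rootsD(1,2)[OF r] by algebra
  moreover have "small \<dots>"
  proof (intro small_diff[OF small_diff])
    show "small (u ^ 2 + a)" by (rule square_plus_a_small[OF u])
    show "small ((u - e) * (u - e))" by (rule small_mult[OF s small_mem[OF s]])
    show "small (2 * (e * (u - e)))"
      by (rule small_even[OF mult_mem[OF unit_mem[OF rootsD(4)[OF r]] small_mem[OF s]]])
  qed
  moreover have "unit (f * g)" by (rule unit_mult[OF rootsD(5,6)[OF r]])
  ultimately show False using not_small_unit by metis
qed

lemma near_root_imp_root:
  assumes "w \<in> S" "e \<in> {e1, e2, e3}" "small (w - e)"
  shows "w = e"
proof (rule ccontr)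
  assume "w \<noteq> e"
  then have "unit (w - e)"
    using assms unit_minus_root[of w e] unit_diff_commute unit_12 unit_13 unit_23 by auto
  then show False using assms(3) not_small_unit by blast
qed

text \<open>
  The next two lemmas say that each factor belonging to a 2-torsion point in
  \<open>x(2P) - x(2Q)\<close> is twice an integral element, and not zero, if \<open>u\<close> and \<open>v\<close> are close.
\<close>
lemma translate_even:
  assumes u: "u \<in> S" "u \<notin> {e1, e2, e3}" and v: "v \<in> S" and c: "(u - v) ^ 2 / 8 \<in> A"
    and r: "roots e f g"
  shows "((u - e) * (v - e) - (e - f) * (e - g)) / 2 \<in> A"
proof -
  have e: "e \<in> A" "f \<in> A" "g \<in> A" using rootsD(4-6)[OF r] by (auto intro: unit_mem)
  have uv: "u \<in> A" "v \<in> A" using integral u v by auto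
  define h k where "h = (u ^ 2 + a) / 2" and "k = (u - v) / 2"
  have hk: "u ^ 2 + a = 2 * h" "u - v = 2 * k" by (simp_all add: h_def k_def)
  have hA: "h \<in> A" unfolding h_def by (rule square_plus_a[OF u])
  have "k ^ 2 = 2 * ((u - v) ^ 2 / 8)" by (simp add: hk(2) power2_eq_square)
  then have "k ^ 2 \<in> A" using c by (simp only:) (intro mult_mem numeral_mem)
  then have kA: "k \<in> A" by (rule square_mem_imp_mem)
  have "(u - e) * (v - e) - (e - f) * (e - g)
      = (u ^ 2 + a) - 2 * (a + u * e + e ^ 2) - (u - e) * (u - v)"
    using rootsD(1,2)[OF r] by algebra
  also have "\<dots> = 2 * (h - (a + u * e + e ^ 2) - (u - e) * k)"
    unfolding hk by algebra
  finally have "(u - e) * (v - e) - (e - f) * (e - g) = 2 * (h - (a + u * e + e ^ 2) - (u - e) * k)" .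
  moreover have "h - (a + u * e + e ^ 2) - (u - e) * k \<in> A"
    using hA kA e uv a_mem by (intro mem)
  moreover have "x / 2 \<in> A" if "x = 2 * y" "y \<in> A" for x y
    using that by simp
  ultimately show ?thesis by blast
qed

text \<open>
  If the factor vanished, \<open>x(2P) - e\<close> would be \<open>((u - e) (u - v))\<^sup>2 / 4\<close> up to a unit, which is small but
  not zero. No element of \<open>S\<close> is that close to a root without
  being that root.
\<close>
lemma translate_nonzero:
  assumes u: "u \<in> S" "u \<notin> {e1, e2, e3}" and "u \<noteq> v" and c: "(u - v) ^ 2 / 8 \<in> A"
    and r: "roots e f g"
  shows "(u - e) * (v - e) - (e - f) * (e - g) \<noteq> 0"
proof
  assume z: "(u - e) * (v - e) - (e - f) * (e - g) = 0"
  have e: "e \<in> {e1, e2, e3}" using rootsD(10)[OF r] by blast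
  have nr: "u \<noteq> e" "u \<noteq> f" "u \<noteq> g" using u(2) unfolding rootsD(10)[OF r, symmetric] by blast+
  have F: "(u - e1) * (u - e2) * (u - e3) = (u - e) * (u - f) * (u - g)"
    using cubic_factor[OF rootsD(1-3)[OF r], of u] factor[of u] by simp
  obtain w where w: "w \<in> S"
    "4 * ((u - e1) * (u - e2) * (u - e3)) * w = (u ^ 2 + a) ^ 2 - 4 * a * u ^ 2 - 8 * b * u"
    using double u by blast
  have "4 * ((u - e) * (u - f) * (u - g)) * (w - e) = ((u - e) ^ 2 - (e - f) * (e - g)) ^ 2"
    by (rule doubling_minus_root[OF rootsD(1-3)[OF r] w(2)[unfolded F]])
  also have "(u - e) ^ 2 - (e - f) * (e - g) = (u - e) * (u - v)"
    using z by algebra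
  finally have we: "4 * ((u - e) * (u - f) * (u - g)) * (w - e) = ((u - e) * (u - v)) ^ 2" .
  define k where "k = (u - v) ^ 2 / 8"
  have "(u - v) ^ 2 = 8 * k" by (simp add: k_def)
  then have "4 * ((u - e) * (u - f) * (u - g) * (w - e)) = 4 * (2 * ((u - e) ^ 2 * k))"
    using we by algebra
  then have "(u - e1) * (u - e2) * (u - e3) * (w - e) = 2 * ((u - e) ^ 2 * k)"
    unfolding F by (simp only: mult_cancel_left) simp
  moreover have "small \<dots>"
    using c u integral e root_mem unfolding k_def by (intro small_even mult_mem power_mem diff_mem) auto
  moreover have "unit ((u - e1) * (u - e2) * (u - e3))"
    using unit_minus_root[OF u] by (intro unit_mult) auto
  ultimately have "small (w - e)" using small_cancel_unit by metis
  then have "w = e" using near_root_imp_root w(1) e by blast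
  then show False using we nr \<open>u \<noteq> v\<close> by simp
qed

text \<open>
  Doubling contracts: the three factors above contribute \<open>8\<close> against the \<open>4\<close> in the denominator, so
  \<open>x(2P) - x(2Q)\<close> is strictly smaller than \<open>u - v\<close>, and not zero. Hence no two non-roots satisfy
  \<open>\<bar>u - v\<bar>\<^sup>2 \<le> \<bar>8\<bar>\<close>: doubling the closest one of these finitely many pairs would give an even closer one.
\<close>
lemma separation:
  assumes "u \<in> S" "u \<notin> {e1, e2, e3}" "v \<in> S" "v \<notin> {e1, e2, e3}" "u \<noteq> v"
  shows "(u - v) ^ 2 / 8 \<notin> A"
proof
  define T where "T = {(u, v) \<in> S \<times> S. u \<notin> {e1, e2, e3} \<and> v \<notin> {e1, e2, e3} \<and> u \<noteq> v \<and>
    (u - v) ^ 2 / 8 \<in> A}"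
  assume "(u - v) ^ 2 / 8 \<in> A"
  then have "(u, v) \<in> T" using assms by (simp add: T_def)
  moreover have "finite T"
    by (rule finite_subset[of _ "S \<times> S"]) (use fin in \<open>auto simp: T_def\<close>)
  ultimately have "finite ((\<lambda>(u, v). inverse (u - v)) ` T)" "(\<lambda>(u, v). inverse (u - v)) ` T \<noteq> {}"
    "0 \<notin> (\<lambda>(u, v). inverse (u - v)) ` T"
    by (auto simp: T_def)
  then obtain x where x: "x \<in> (\<lambda>(u, v). inverse (u - v)) ` T"
    "\<And>y. y \<in> (\<lambda>(u, v). inverse (u - v)) ` T \<Longrightarrow> y * inverse x \<in> A"
    using exists_largest by blast
  obtain p where p: "p \<in> T" "x = (\<lambda>(u, v). inverse (u - v)) p" using x(1) by (rule imageE)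
  obtain u v where uv: "p = (u, v)" by (cases p)
  have uvT: "(u, v) \<in> T" using p uv by simp
  have least: "inverse (u' - v') * (u - v) \<in> A" if "(u', v') \<in> T" for u' v'
    using x(2)[OF imageI[OF that]] by (simp add: p(2) uv)
  have u: "u \<in> S" "u \<notin> {e1, e2, e3}" and v: "v \<in> S" "v \<notin> {e1, e2, e3}" and "u \<noteq> v"
    and c: "(u - v) ^ 2 / 8 \<in> A"
    using uvT by (auto simp: T_def)
  obtain u' where u': "u' \<in> S"
    "4 * ((u - e1) * (u - e2) * (u - e3)) * u' = (u ^ 2 + a) ^ 2 - 4 * a * u ^ 2 - 8 * b * u"
    using double u by blast
  obtain v' where v': "v' \<in> S"
    "4 * ((v - e1) * (v - e2) * (v - e3)) * v' = (v ^ 2 + a) ^ 2 - 4 * a * v ^ 2 - 8 * b * v"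
    using double v by blast
  define s1 where "s1 = ((u - e1) * (v - e1) - (e1 - e2) * (e1 - e3)) / 2"
  define s2 where "s2 = ((u - e2) * (v - e2) - (e2 - e1) * (e2 - e3)) / 2"
  define s3 where "s3 = ((u - e3) * (v - e3) - (e3 - e1) * (e3 - e2)) / 2"
  have s: "s1 \<in> A" "s2 \<in> A" "s3 \<in> A" "s1 \<noteq> 0" "s2 \<noteq> 0" "s3 \<noteq> 0"
    unfolding s1_def s2_def s3_def
    using translate_even[OF u v(1) c] translate_nonzero[OF u \<open>u \<noteq> v\<close> c] roots_perm by auto
  define F where "F = (u - e1) * (u - e2) * (u - e3) * ((v - e1) * (v - e2) * (v - e3))"
  have F: "unit F"
    unfolding F_def using unit_minus_root[OF u] unit_minus_root[OF v] by (intro unit_mult) auto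
  have translates: "(u - e1) * (v - e1) - (e1 - e2) * (e1 - e3) = 2 * s1"
    "(u - e2) * (v - e2) - (e2 - e1) * (e2 - e3) = 2 * s2"
    "(u - e3) * (v - e3) - (e3 - e1) * (e3 - e2) = 2 * s3"
    by (simp_all add: s1_def s2_def s3_def)
  have "4 * F * (u' - v') = (u - v) * (2 * s1) * (2 * s2) * (2 * s3)"
    using doubling_difference[OF sum_0 a b u'(2) v'(2)] unfolding translates F_def
    by (simp only: mult.assoc)
  then have "4 * (F * (u' - v')) = 4 * ((u - v) * (2 * (s1 * s2 * s3)))"
    by algebra
  then have Fd: "F * (u' - v') = (u - v) * (2 * (s1 * s2 * s3))"
    by (simp only: mult_cancel_left) simp
  define q where "q = inverse F * (2 * (s1 * s2 * s3))"
  have q: "small q"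
    unfolding q_def using F s by (intro small_mult' small_even mem) (auto simp: unit_def)
  have "u' - v' = inverse F * (F * (u' - v'))" using F by (simp add: unit_def)
  then have d: "u' - v' = (u - v) * q"
    unfolding Fd q_def by simp
  have "q \<noteq> 0" using s F by (simp add: q_def unit_def)
  then have ne: "u' \<noteq> v'" using d \<open>u \<noteq> v\<close> by auto
  have uv_mem: "u - v \<in> A" using integral u v by (auto intro: mem)
  have sd: "small (u' - v')" unfolding d by (rule small_mult'[OF uv_mem q])
  have "u' \<notin> {e1, e2, e3}"
    using near_root_imp_root[OF v'(1), of u'] small_uminus[OF sd] ne by auto
  moreover have "v' \<notin> {e1, e2, e3}"
    using near_root_imp_root[OF u'(1), of v'] sd ne by auto
  moreover have "(u' - v') ^ 2 / 8 \<in> A"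
  proof -
    have "(u' - v') ^ 2 / 8 = (u - v) ^ 2 / 8 * q ^ 2" by (simp add: d power_mult_distrib)
    then show ?thesis using c small_mem[OF q] by (simp only:) (intro mem)
  qed
  ultimately have "(u', v') \<in> T" using u' v' ne by (simp add: T_def)
  then have "inverse (u' - v') * (u - v) \<in> A" by (rule least)
  moreover have "inverse (u' - v') * (u - v) = inverse q"
  proof -
    have "inverse (x * q) * x = inverse q" if "x \<noteq> 0" for x using that by simp
    then show ?thesis unfolding d using \<open>u \<noteq> v\<close> by simp
  qed
  ultimately show False using q \<open>q \<noteq> 0\<close> by (simp add: small_def)
qed

text \<open>
  Roots are units, so \<open>2t\<close> is not a root. The squares of \<open>2t\<close> and of a non-root among \<open>t\<close>, \<open>3t\<close> agree
  modulo \<open>2\<close>, and their difference is \<open>t\<^sup>2\<close> up to a unit; thus \<open>t\<^sup>2 / 2\<close> is integral. Then \<open>t\<close> and \<open>3t\<close>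
  are small, hence not roots either, and their distance \<open>2t\<close> violates the separation bound.
\<close>
lemma not_three_multiples:
  assumes S: "t \<in> S" "2 * t \<in> S" "3 * t \<in> S" and t0: "t \<noteq> 0"
    and two: "\<not> (t \<in> {e1, e2, e3} \<and> 3 * t \<in> {e1, e2, e3})"
  shows False
proof -
  have t: "t \<in> A" using S integral by blast
  have roots_unit: "unit e" if "e \<in> {e1, e2, e3}" for e using that unit_root by blast
  have nr2: "2 * t \<notin> {e1, e2, e3}"
    using roots_unit[of "2 * t"] small_even[OF t] not_small_unit by blast
  have u3: "unit 3" using unit_odd[OF one_mem] by simp
  have u5: "unit 5" using unit_odd[of 2] by (simp add: numeral_mem)
  have half_sq: "t ^ 2 / 2 \<in> A"
  proof (cases "t \<in> {e1, e2, e3}")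
    case False
    have "(2 * t) ^ 2 + a - (t ^ 2 + a) = 3 * t ^ 2" by algebra
    then have "3 * (t ^ 2 / 2) = ((2 * t) ^ 2 + a) / 2 - (t ^ 2 + a) / 2"
      by (simp add: diff_divide_distrib[symmetric])
    also have "\<dots> \<in> A"
      by (rule diff_mem[OF square_plus_a[OF S(2) nr2] square_plus_a[OF S(1) False]])
    finally show ?thesis using mem_cancel_unit u3 by blast
  next
    case True
    have "(3 * t) ^ 2 + a - ((2 * t) ^ 2 + a) = 5 * t ^ 2" by algebra
    then have "5 * (t ^ 2 / 2) = ((3 * t) ^ 2 + a) / 2 - ((2 * t) ^ 2 + a) / 2"
      by (simp add: diff_divide_distrib[symmetric])
    also have "\<dots> \<in> A"
    proof (rule diff_mem[OF square_plus_a[OF S(3)] square_plus_a[OF S(2) nr2]])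
      show "3 * t \<notin> {e1, e2, e3}" using two True by blast
    qed
    finally show ?thesis using mem_cancel_unit u5 by blast
  qed
  then have "small (t ^ 2)" using small_even[of "t ^ 2 / 2"] by simp
  then have st: "small t" by (rule small_square)
  have "t \<notin> {e1, e2, e3}" using roots_unit[of t] st not_small_unit by blast
  moreover have "3 * t \<notin> {e1, e2, e3}"
    using roots_unit[of "3 * t"] small_mult'[OF numeral_mem st] not_small_unit by blast
  moreover have "t \<noteq> 3 * t"
  proof
    assume "t = 3 * t"
    then have "2 * t = 0" by algebra
    then show False using t0 by simp
  qed
  ultimately have "(t - 3 * t) ^ 2 / 8 \<notin> A"
    using separation[OF S(1) _ S(3)] by blast
  moreover have "(t - 3 * t) ^ 2 / 8 = t ^ 2 / 2" by (simp add: power2_eq_square)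
  ultimately show False using half_sq by simp
qed

end

section \<open>The abscissas 1, 2 and 3\<close>

text \<open>
  So two roots have the same reduction, and all of \<open>t\<close>, \<open>2t\<close>, \<open>3t\<close> except possibly \<open>e3\<close> are units with the same
  reduction. This leaves \<open>2t = e3\<close> with \<open>t\<close> a unit. One duplication of the points over \<open>t\<close> and \<open>3t\<close> then
  gives two congruences that contradict each other, unless the doubled point is \<open>e3\<close>, that is
  \<open>a = - 11 t\<^sup>2\<close>.
\<close>
lemma (in dyadic_curve) three_multiples:
  assumes S: "t \<in> S" "2 * t \<in> S" "3 * t \<in> S" and t0: "t \<noteq> 0"
    and two: "\<not> (t \<in> {e1, e2, e3} \<and> 2 * t \<in> {e1, e2, e3})"
      "\<not> (t \<in> {e1, e2, e3} \<and> 3 * t \<in> {e1, e2, e3})"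
      "\<not> (2 * t \<in> {e1, e2, e3} \<and> 3 * t \<in> {e1, e2, e3})"
  shows "2 * t = e3 \<and> a = - 11 * t ^ 2"
proof -
  have t: "t \<in> A" using S integral by blast
  have "\<not> unit (e1 - e2)"
  proof
    assume "unit (e1 - e2)"
    then interpret separated_dyadic_curve A a b e1 e2 e3 S
      by unfold_locales
    show False using not_three_multiples S t0 two(2) by blast
  qed
  then have e12: "small (e1 - e2)" using unit_or_small diff_12 by blast
  note near = coalescing_roots(2)[OF e12]
  have e3: "2 * t = e3"
  proof (rule ccontr)
    assume "2 * t \<noteq> e3"
    then have "small (2 * t - (2 * t - e1))" by (rule small_diff[OF small_even[OF t] near[OF S(2)]])
    then show False using coalescing_roots(1)[OF e12] not_small_unit by simp
  qed
  have nr: "t \<notin> {e1, e2, e3}" "3 * t \<notin> {e1, e2, e3}"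
    using two e3 by blast+
  have te: "small (t - e1)" using near S nr by blast
  have ut: "unit t"
    using unit_add_small[OF coalescing_roots(1)[OF e12] te] by simp
  \<comment> \<open>With \<open>X = x / t - 2\<close> the cubic is \<open>t\<^sup>3 X (X\<^sup>2 + 6 X + c)\<close> once \<open>2t\<close> is a root, and \<open>t\<close>, \<open>3t\<close> become \<open>X = - 1\<close>, \<open>X = 1\<close>.\<close>
  define c where "c = a / t ^ 2 + 12"
  have ac: "a = (c - 12) * t ^ 2" using t0 by (simp add: c_def)
  have bt: "b = - 8 * t ^ 3 - 2 * a * t"
  proof -
    have "(2 * t) ^ 3 + a * (2 * t) + b = 0" unfolding factor e3 by simp
    then show ?thesis by algebra
  qed
  have f1: "(t - e1) * (t - e2) * (t - e3) = - (c - 5) * t ^ 3"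
    unfolding factor[symmetric] bt ac by algebra
  have f3: "(3 * t - e1) * (3 * t - e2) * (3 * t - e3) = (c + 7) * t ^ 3"
    unfolding factor[symmetric] bt ac by algebra
  have "c = 1"
  proof (rule ccontr)
    assume c1: "c \<noteq> 1"
    obtain w1 where w1: "w1 \<in> S"
      "4 * (- (c - 5) * t ^ 3) * w1 = (t ^ 2 + a) ^ 2 - 4 * a * t ^ 2 - 8 * b * t"
      using double[OF S(1) nr(1)] unfolding f1 by blast
    obtain w3 where w3: "w3 \<in> S"
      "4 * ((c + 7) * t ^ 3) * w3 = ((3 * t) ^ 2 + a) ^ 2 - 4 * a * (3 * t) ^ 2 - 8 * b * (3 * t)"
      using double[OF S(3) nr(2)] unfolding f3 by blast
    \<comment> \<open>The \<open>X\<close>-coordinates of the doubled points; unless they are \<open>0\<close>, they reduce to \<open>1\<close>.\<close>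
    define y1 y3 where "y1 = w1 / t - 2" and "y3 = w3 / t - 2"
    have wt: "w1 = (y1 + 2) * t" "w3 = (y3 + 2) * t"
      using t0 by (simp_all add: y1_def y3_def)
    have t4: "t ^ 4 \<noteq> 0" using t0 by simp
    have "t ^ 4 * (4 * (c - 5) * y1) = t ^ 4 * (- ((c - 1) ^ 2))"
      using w1(2) unfolding wt bt ac by algebra
    then have y1: "4 * (c - 5) * y1 = - ((c - 1) ^ 2)" by (rule mult_left_cancel[OF t4, THEN iffD1])
    have "t ^ 4 * (4 * (c + 7) * y3) = t ^ 4 * ((c - 1) ^ 2)"
      using w3(2) unfolding wt bt ac by algebra
    then have y3: "4 * (c + 7) * y3 = (c - 1) ^ 2" by (rule mult_left_cancel[OF t4, THEN iffD1])
    have y_small: "small (y - 1)" if "w \<in> S" "w = (y + 2) * t" "y \<noteq> 0" for w y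
    proof -
      have "w \<noteq> e3" using that t0 e3 by auto
      then have "small ((w - e1) - (t - e1) - 2 * t)"
        by (rule small_diff[OF small_diff[OF near[OF that(1)] te] small_even[OF t]])
      also have "(w - e1) - (t - e1) - 2 * t = t * (y - 1)"
        using that(2) by algebra
      finally show ?thesis using small_cancel_unit[OF ut] by blast
    qed
    have "y1 \<noteq> 0" "y3 \<noteq> 0" using y1 y3 c1 by auto
    then have s1: "small (y1 - 1)" and s3: "small (y3 - 1)"
      using y_small[OF w1(1) wt(1)] y_small[OF w3(1) wt(2)] by blast+
    have y1A: "y1 \<in> A" using add_mem[OF small_mem[OF s1] one_mem] by simp
    define k where "k = (c - 1) / 4"
    have "4 * k = c - 1" by (simp add: k_def)
    then have ck: "c = 4 * k + 1" by algebra
    have "16 * ((k - 1) * y1) = 16 * (- (k ^ 2))" using y1 unfolding ck by algebra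
    then have k1: "(k - 1) * y1 = - (k ^ 2)" by (simp only: mult_cancel_left) simp
    have "16 * ((k + 2) * y3) = 16 * k ^ 2" using y3 unfolding ck by algebra
    then have k3: "(k + 2) * y3 = k ^ 2" by (simp only: mult_cancel_left mult.assoc) simp
    have kA: "k \<in> A"
    proof (rule ccontr)
      assume k: "k \<notin> A"
      define s where "s = inverse k"
      have "k \<noteq> 0" using k zero_mem by metis
      then have s: "small s" "s * k = 1" using small_inverse[OF k] by (simp_all add: s_def)
      have "1 = s * (s * y1) - s * y1" using k1 s(2) by algebra
      moreover have "small \<dots>"
        using s(1) y1A by (intro small_diff small_mult mem small_mem[OF s(1)])
      ultimately show False using unit_1 not_small_unit by metis
    qed
    \<comment> \<open>In the residue field \<open>k\<^sup>2 = 1 - k\<close> and \<open>k\<^sup>2 = k + 2\<close>, where \<open>2 = 0\<close>; their difference is \<open>1 = 0\<close>.\<close>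
    have "1 = (y1 - 1) * (1 - k) - (y3 - 1) * (k + 2) - 2 * k"
      using k1 k3 by algebra
    moreover have "small \<dots>"
      using s1 s3 kA by (intro small_diff[OF small_diff] small_mult small_even mem)
    ultimately show False using unit_1 not_small_unit by metis
  qed
  then show ?thesis using e3 ac by simp
qed

lemma doubling_closed_scale:
  fixes a b d :: "'a::field"
  assumes S: "doubling_closed a b S" and d: "d \<noteq> 0"
  shows "doubling_closed (a / d ^ 2) (b / d ^ 3) ((\<lambda>x. x / d) ` S)"
  unfolding doubling_closed_def
proof (intro ballI impI)
  fix y assume "y \<in> (\<lambda>x. x / d) ` S" and nz: "y ^ 3 + a / d ^ 2 * y + b / d ^ 3 \<noteq> 0"
  then obtain x where x: "x \<in> S" "y = x / d" by blast
  have cubic: "y ^ 3 + a / d ^ 2 * y + b / d ^ 3 = (x ^ 3 + a * x + b) / d ^ 3"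
    using d by (simp add: x(2) field_simps power2_eq_square power3_eq_cube)
  then have "x ^ 3 + a * x + b \<noteq> 0" using nz by auto
  then obtain u where u: "u \<in> S"
    "4 * (x ^ 3 + a * x + b) * u = (x ^ 2 + a) ^ 2 - 4 * a * x ^ 2 - 8 * b * x"
    using S x(1) unfolding doubling_closed_def by blast
  have "4 * (y ^ 3 + a / d ^ 2 * y + b / d ^ 3) * (u / d) = 4 * (x ^ 3 + a * x + b) * u / d ^ 4"
    unfolding cubic by (simp add: power_numeral_reduce)
  also have "\<dots> = (y ^ 2 + a / d ^ 2) ^ 2 - 4 * (a / d ^ 2) * y ^ 2 - 8 * (b / d ^ 3) * y"
    using d unfolding u(2) x(2) by (simp add: field_simps power_numeral_reduce)
  finally show "\<exists>u\<in>(\<lambda>x. x / d) ` S. 4 * (y ^ 3 + a / d ^ 2 * y + b / d ^ 3) * u =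
      (y ^ 2 + a / d ^ 2) ^ 2 - 4 * (a / d ^ 2) * y ^ 2 - 8 * (b / d ^ 3) * y"
    using u(1) by blast
qed

lemma dyadic_valuation_ring_exists:
  obtains A :: "'a::field_char_0 set" where "valuation_ring A" "inverse 2 \<notin> A"
proof -
  interpret subring_of_field "\<int> :: 'a set" by unfold_locales auto
  have "inverse 2 \<notin> (\<int> :: 'a set)"
  proof
    assume "inverse 2 \<in> (\<int> :: 'a set)"
    then obtain k :: int where "inverse 2 = (of_int k :: 'a)" by (auto elim: Ints_cases)
    then have "of_int (2 * k) = (of_int 1 :: 'a)" by (simp add: field_simps)
    then have "2 * k = 1" by (simp only: of_int_eq_iff)
    then show False by presburger
  qed
  then show thesis using valuation_ring_extension[of 2] that by auto
qed

text \<open>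
  Dividing all coordinates by the largest difference \<open>d\<close> of two roots puts the curve into the scaled form
  above, where the numbers \<open>1\<close>, \<open>2\<close>, \<open>3\<close> become multiples of \<open>t = 1 / d\<close>.
\<close>
lemma abscissas_1_2_3_imp_parameters:
  fixes a b E1 E2 E3 :: "'a::field_char_0"
  assumes E: "E1 + E2 + E3 = 0" "a = E1 * E2 + E1 * E3 + E2 * E3" "b = - E1 * E2 * E3"
    and distinct: "E1 \<noteq> E2" "E1 \<noteq> E3" "E2 \<noteq> E3"
    and S: "finite S" "doubling_closed a b S" "1 \<in> S" "2 \<in> S" "3 \<in> S"
    and two: "\<not> (1 \<in> {E1, E2, E3} \<and> 2 \<in> {E1, E2, E3})"
      "\<not> (1 \<in> {E1, E2, E3} \<and> 3 \<in> {E1, E2, E3})"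
      "\<not> (2 \<in> {E1, E2, E3} \<and> 3 \<in> {E1, E2, E3})"
  shows "a = - 11 \<and> b = 14"
proof -
  obtain A :: "'a set" where "valuation_ring A" and half: "inverse 2 \<notin> A"
    using dyadic_valuation_ring_exists by blast
  then interpret valuation_ring A by simp
  have core: "a = - 11 \<and> b = 14"
    if F: "{F1, F2, F3} = {E1, E2, E3}" "F1 + F2 + F3 = 0"
        "a = F1 * F2 + F1 * F3 + F2 * F3" "b = - F1 * F2 * F3"
      and d: "d \<noteq> 0" "unit ((F1 - F3) / d)" "unit ((F2 - F3) / d)" "(F1 - F2) / d \<in> A"
    for F1 F2 F3 d
  proof -
    interpret dyadic_curve A "a / d ^ 2" "b / d ^ 3" "F1 / d" "F2 / d" "F3 / d" "(\<lambda>x. x / d) ` S"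
    proof
      show "inverse 2 \<notin> A" by (rule half)
      show "F1 / d + F2 / d + F3 / d = 0"
        using F(2) by (simp add: add_divide_distrib[symmetric])
      show "a / d ^ 2 = F1 / d * (F2 / d) + F1 / d * (F3 / d) + F2 / d * (F3 / d)"
        unfolding F(3) by (simp add: add_divide_distrib power2_eq_square)
      show "b / d ^ 3 = - (F1 / d) * (F2 / d) * (F3 / d)"
        unfolding F(4) by (simp add: power3_eq_cube)
      show "doubling_closed (a / d ^ 2) (b / d ^ 3) ((\<lambda>x. x / d) ` S)"
        by (rule doubling_closed_scale[OF S(2) d(1)])
    qed (use d S(1) in \<open>simp_all add: diff_divide_distrib\<close>)
    have mem_iff: "x / d \<in> {F1 / d, F2 / d, F3 / d} \<longleftrightarrow> x \<in> {E1, E2, E3}" for x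
      unfolding F(1)[symmetric] using d(1) by auto
    have "2 * (1 / d) = F3 / d \<and> a / d ^ 2 = - 11 * (1 / d) ^ 2"
    proof (rule three_multiples)
      show "1 / d \<in> (\<lambda>x. x / d) ` S" "2 * (1 / d) \<in> (\<lambda>x. x / d) ` S" "3 * (1 / d) \<in> (\<lambda>x. x / d) ` S"
        using S(3-5) by force+
      show "1 / d \<noteq> 0" using d(1) by simp
    qed (use two in \<open>simp_all only: times_divide_eq_right mult_1_right mem_iff not_False_eq_True\<close>)
    then have F3: "F3 = 2" and a: "a = - 11" using d(1) by (auto simp: field_simps)
    have "8 + 2 * a + b = 0"
      using F(2-4) F3 by algebra
    then have "b = 14" using a by algebra
    with a show ?thesis ..
  qed
  \<comment> \<open>Of the two differences that sum up to the largest one, at least one is as large; it fixes \<open>e3\<close>.\<close>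
  have main: "a = - 11 \<and> b = 14"
    if F: "{F, G, H} = {E1, E2, E3}" "F + G + H = 0"
        "a = F * G + F * H + G * H" "b = - F * G * H"
      and d: "F - H \<noteq> 0" "(F - G) / (F - H) \<in> A" "(G - H) / (F - H) \<in> A"
    for F G H
  proof -
    have one: "(F - G) / (F - H) + (G - H) / (F - H) = 1"
      using d(1) by (simp add: add_divide_distrib[symmetric])
    have swap: "x / (F - H) = - ((- x) / (F - H))" for x by simp
    show ?thesis
    proof (cases "unit ((G - H) / (F - H))")
      case True
      then show ?thesis
        using core[OF F d(1) _ True d(2)] d(1) unit_1 by simp
    next
      case False
      then have "small ((G - H) / (F - H))" using unit_or_small d(3) by blast
      then have u: "unit ((F - G) / (F - H))"
        using unit_diff_small[OF unit_1] one by (metis add_diff_cancel_right')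
      show ?thesis
      proof (rule core)
        show "{H, G, F} = {E1, E2, E3}" using F(1) by blast
        show "H + G + F = 0" "a = H * G + H * F + G * F" "b = - H * G * F"
          using F(2-4) by algebra+
        show "F - H \<noteq> 0" by (rule d(1))
        have "(H - F) / (F - H) = - 1" using d(1) by (simp add: field_simps)
        then show "unit ((H - F) / (F - H))" using unit_uminus[OF unit_1] by simp
        show "unit ((G - F) / (F - H))"
          using unit_uminus[OF u] by (simp add: minus_divide_left)
        show "(H - G) / (F - H) \<in> A"
          using uminus_mem[OF d(3)] by (simp add: minus_divide_left)
      qed
    qed
  qed
  have "finite {E1 - E2, E1 - E3, E2 - E3}" "{E1 - E2, E1 - E3, E2 - E3} \<noteq> {}"
    "0 \<notin> {E1 - E2, E1 - E3, E2 - E3}"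
    using distinct by auto
  then obtain d where d: "d \<in> {E1 - E2, E1 - E3, E2 - E3}"
    "\<And>y. y \<in> {E1 - E2, E1 - E3, E2 - E3} \<Longrightarrow> y / d \<in> A"
    using exists_largest unfolding divide_inverse by blast
  have d': "(y - x) / d \<in> A" if "x - y \<in> {E1 - E2, E1 - E3, E2 - E3}" for x y
    using uminus_mem[OF d(2)[OF that]] by (simp add: minus_divide_left)
  consider "d = E1 - E2" | "d = E1 - E3" | "d = E2 - E3" using d(1) by blast
  then show ?thesis
  proof cases
    case 1
    show ?thesis
      by (rule main[of E1 E3 E2])
        (use E distinct d(2)[of "E1 - E3"] d'[of E2 E3] 1 in \<open>auto simp: algebra_simps\<close>)
  next
    case 2
    show ?thesis
      by (rule main[of E1 E2 E3])
        (use E distinct d(2)[of "E1 - E2"] d(2)[of "E2 - E3"] 2 in auto)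
  next
    case 3
    show ?thesis
      by (rule main[of E2 E1 E3])
        (use E distinct d'[of E1 E2] d(2)[of "E1 - E3"] 3 in \<open>auto simp: algebra_simps\<close>)
  qed
qed

lemma complex_cubic_splits:
  fixes a b :: complex
  obtains E1 E2 E3 where "E1 + E2 + E3 = 0" "a = E1 * E2 + E1 * E3 + E2 * E3" "b = - E1 * E2 * E3"
proof -
  have "\<not> constant (poly [:b, a, 0, 1:])"
    by (subst constant_degree) simp
  then obtain z where "poly [:b, a, 0, 1:] z = 0"
    using fundamental_theorem_of_algebra by blast
  then have z: "b = - z * (a + z ^ 2)"
    by (simp add: algebra_simps power2_eq_square power3_eq_cube eq_neg_iff_add_eq_0)
  define s where "s = csqrt (z ^ 2 - 4 * (a + z ^ 2))"
  have s: "s ^ 2 = z ^ 2 - 4 * (a + z ^ 2)" by (simp add: s_def)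
  define f g where "f = (s - z) / 2" and "g = (- s - z) / 2"
  have fg: "2 * f = s - z" "2 * g = - s - z" by (simp_all add: f_def g_def)
  have "4 * (f * g) = 4 * (a + z ^ 2)" using fg s by algebra
  then have prod: "f * g = a + z ^ 2" by (simp only: mult_cancel_left) simp
  have "2 * (z + f + g) = 0" using fg by algebra
  then have sum: "z + f + g = 0" by (simp only: mult_eq_0_iff) simp
  have "a = z * f + z * g + f * g" "b = - z * f * g"
    using z prod sum by algebra+
  with sum show thesis by (rule that)
qed

text \<open>If two of \<open>1\<close>, \<open>2\<close>, \<open>3\<close> are roots of the cubic, two linear equations determine \<open>a\<close> and \<open>b\<close>.\<close>
lemma torsion_parameters:
  fixes a b :: complex
  assumes disc: "4 * a ^ 3 + 27 * b ^ 2 \<noteq> 0"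
    and tor: "ec_torsion a b (Affine 1 y1)" "ec_torsion a b (Affine 2 y2)" "ec_torsion a b (Affine 3 y3)"
  shows "(a, b) \<in> {(- 7, 6), (- 13, 12), (- 19, 30), (- 11, 14)}"
proof -
  obtain S1 S2 S3 where S: "finite S1" "doubling_closed a b S1" "1 \<in> S1"
    "finite S2" "doubling_closed a b S2" "2 \<in> S2" "finite S3" "doubling_closed a b S3" "3 \<in> S3"
    using torsion_imp_finite_doubling_closed[OF disc] tor by metis
  define S where "S = S1 \<union> S2 \<union> S3"
  have S': "finite S" "doubling_closed a b S" "1 \<in> S" "2 \<in> S" "3 \<in> S"
    unfolding S_def using S doubling_closed_Un[OF doubling_closed_Un[OF S(2,5)] S(8)] by simp_all
  obtain E1 E2 E3 where E: "E1 + E2 + E3 = 0" "a = E1 * E2 + E1 * E3 + E2 * E3" "b = - E1 * E2 * E3"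
    using complex_cubic_splits .
  have "4 * a ^ 3 + 27 * b ^ 2 = - (((E1 - E2) * (E1 - E3) * (E2 - E3)) ^ 2)"
    using E by algebra
  then have distinct: "E1 \<noteq> E2" "E1 \<noteq> E3" "E2 \<noteq> E3" using disc by auto
  have root: "x ^ 3 + a * x + b = 0" if "x \<in> {E1, E2, E3}" for x
    unfolding cubic_factor[OF E] using that by auto
  consider "1 \<in> {E1, E2, E3} \<and> 2 \<in> {E1, E2, E3}" | "1 \<in> {E1, E2, E3} \<and> 3 \<in> {E1, E2, E3}"
    | "2 \<in> {E1, E2, E3} \<and> 3 \<in> {E1, E2, E3}" | "a = - 11 \<and> b = 14"
    using abscissas_1_2_3_imp_parameters[OF E distinct S'] by blast
  then show ?thesis
  proof cases
    case 1
    then have "1 + a + b = 0" "8 + 2 * a + b = 0" using root[of 1] root[of 2] by (auto simp: mult.commute)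
    then have "a = - 7" "b = 6" by algebra+
    then show ?thesis by simp
  next
    case 2
    then have "1 + a + b = 0" "27 + 3 * a + b = 0" using root[of 1] root[of 3] by (auto simp: mult.commute)
    then have "2 * a = 2 * (- 13)" "2 * b = 2 * 12" by algebra+
    then show ?thesis by simp
  next
    case 3
    then have "8 + 2 * a + b = 0" "27 + 3 * a + b = 0" using root[of 2] root[of 3] by (auto simp: mult.commute)
    then have "a = - 19" "b = 30" by algebra+
    then show ?thesis by simp
  qed simp
qed

theorem theorem1:
  "finite {(a :: complex, b :: complex).
     4 * a ^ 3 + 27 * b ^ 2 \<noteq> 0 \<and>
     ec_torsion a b (Affine 1 (csqrt (1 + a + b))) \<and>
     ec_torsion a b (Affine 2 (csqrt (8 + 2 * a + b))) \<and>
     ec_torsion a b (Affine 3 (csqrt (27 + 3 * a + b)))}"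
  by (rule finite_subset[of _ "{(- 7, 6), (- 13, 12), (- 19, 30), (- 11, 14)}"])
    (use torsion_parameters in blast, simp)

end
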